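(* Let $T$ be a measure-preserving transformation on the probability space $(Y,\mathcal{B},\nu)$ and let $h\in L^2(Y,\mathcal{B},\nu)$ be such that $\int h(y)\,\nu(dy)=0$. Suppose that $$\sum_{n=1}^\infty n^{-\frac32}\left\|\sum_{k=0}^{n-1}\mathcal{P}_{T,\nu}^k h\right\|_2<\infty.$$ Then there exists $\tilde h\in L^2(Y,\mathcal{B},\nu)$ such that $\mathcal{P}_{T,\nu}\tilde h=0$ and $\frac{1}{\sqrt n}\sum_{j=0}^{n-1}(h-\tilde h)\circ T^j$ converges to zero in $L^2(Y,\mathcal{B},\nu)$ as $n\to\infty$. In particular, if $T$ is ergodic, then the CLT holds for $h$ provided that $\|\tilde h\|_2>0$.
   Context: $T:Y\to Y$ is measure preserving if it is measurable and $\nu(T^{-1}(A))=\nu(A)$ for all $A\in\mathcal{B}$; it is ergodic if every $A\in\mathcal{B}$ with $T^{-1}(A)=A$ has $\nu(A)\in\{0,1\}$. $T$ is not assumed invertible. $\|\cdot\|_p$ is the norm of $L^p(Y,\mathcal{B},\nu)$; functions are real-valued. Transfer operator: $\mathcal{P}_{T,\nu}:L^1(Y,\mathcal{B},\nu)\to L^1(Y,\mathcal{B},\nu)$ is defined by letting $\mathcal{P}_{T,\nu}f$ be the unique element of $L^1(Y,\mathcal{B},\nu)$ with $\int_A \mathcal{P}_{T,\nu}f(y)\,\nu(dy)=\int_{T^{-1}(A)}f(y)\,\nu(dy)$ for all $A\in\mathcal{B}$. $\mathcal{P}_{T,\nu}^k$ denotes its $k$-th iterate, with $\mathcal{P}_{T,\nu}^0$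 the identity. The CLT holds for $h$ if, for some $\sigma>0$, the distributions (under $\nu$) of $\frac{1}{\sqrt n}\sum_{j=0}^{n-1}h\circ T^j$ converge weakly to the normal distribution $N(0,\sigma^2)$. *)

theory Defs
  imports "HOL-Probability.Probability"
begin

text \<open>
  Elements of \<open>L\<^sup>p(M)\<close> are represented by real-valued functions; equality in \<open>L\<^sup>p(M)\<close>
  is equality almost everywhere.
\<close>

definition square_integrable :: "'a measure \<Rightarrow> ('a \<Rightarrow> real) \<Rightarrow> bool" where
  "square_integrable M f \<longleftrightarrow> f \<in> borel_measurable M \<and> integrable M (\<lambda>y. (f y)\<^sup>2)"

text \<open>The following is the \<open>L\<^sup>2\<close> norm only for square-integrable functions.\<close>

definition L2_norm :: "'a measure \<Rightarrow> ('a \<Rightarrow> real) \<Rightarrow> real" where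
  "L2_norm M f = sqrt (\<integral>y. (f y)\<^sup>2 \<partial>M)"

definition measure_preserving :: "'a measure \<Rightarrow> ('a \<Rightarrow> 'a) \<Rightarrow> bool" where
  "measure_preserving M T \<longleftrightarrow>
     T \<in> measurable M M \<and> (\<forall>A\<in>sets M. emeasure M (T -` A \<inter> space M) = emeasure M A)"

definition ergodic :: "'a measure \<Rightarrow> ('a \<Rightarrow> 'a) \<Rightarrow> bool" where
  "ergodic M T \<longleftrightarrow>
     measure_preserving M T \<and>
     (\<forall>A\<in>sets M. T -` A \<inter> space M = A \<longrightarrow> measure M A \<in> {0, 1})"

definition is_transfer :: "'a measure \<Rightarrow> ('a \<Rightarrow> 'a) \<Rightarrow> ('a \<Rightarrow> real) \<Rightarrow> ('a \<Rightarrow> real) \<Rightarrow> bool" where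
  "is_transfer M T f g \<longleftrightarrow>
     integrable M g \<and> (\<forall>A\<in>sets M. (LINT y:A|M. g y) = (LINT y:T -` A \<inter> space M|M. f y))"

text \<open>
  The value is a choice of representative of the \<open>L\<^sup>1\<close> class; existence and almost-everywhere
  uniqueness are shown below. The choice depends on \<open>f\<close> only through its integrals, so
  iterating on representatives is unproblematic. For non-integrable \<open>f\<close> the value is meaningless.
\<close>

definition transfer_op :: "'a measure \<Rightarrow> ('a \<Rightarrow> 'a) \<Rightarrow> ('a \<Rightarrow> real) \<Rightarrow> 'a \<Rightarrow> real" where
  "transfer_op M T f = (SOME g. is_transfer M T f g)"

lemma is_transfer_unique:
  assumes "is_transfer M T f g" "is_transfer M T f g'"
  shows "AE y in M. g y = g' y"
  using assms unfolding is_transfer_def by (intro density_unique_real) auto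

lemma is_transfer_exists_nonneg:
  assumes "prob_space M" and mp: "measure_preserving M T"
    and f: "integrable M f" and f0: "\<And>y. 0 \<le> f y"
  shows "\<exists>g. is_transfer M T f g"
proof -
  interpret prob_space M by fact
  have T [measurable]: "T \<in> measurable M M"
    using mp by (simp add: measure_preserving_def)
  have [measurable]: "f \<in> borel_measurable M" using f by simp
  define N where "N = distr (density M (\<lambda>y. ennreal (f y))) M T"
  have sets_N: "sets N = sets M" by (simp add: N_def)
  have N: "emeasure N A = ennreal (LINT y:T -` A \<inter> space M|M. f y)" if A [measurable]: "A \<in> sets M" for A
  proof -
    have B [measurable]: "T -` A \<inter> space M \<in> sets M" by measurable
    have "emeasure N A = (\<integral>\<^sup>+y. ennreal (f y) * indicator (T -` A \<inter> space M) y \<partial>M)"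
      by (simp add: N_def emeasure_distr emeasure_density)
    also have "\<dots> = (\<integral>\<^sup>+y. ennreal (indicator (T -` A \<inter> space M) y * f y) \<partial>M)"
      by (intro nn_integral_cong) (auto split: split_indicator)
    also have "\<dots> = ennreal (LINT y:T -` A \<inter> space M|M. f y)"
      using integrable_mult_indicator[OF B f] f0
      by (subst nn_integral_eq_integral) (auto simp: set_lebesgue_integral_def)
    finally show ?thesis .
  qed
  have fin: "finite_measure N"
    by (rule finite_measureI) (use N[of "space M"] in \<open>simp add: N_def\<close>)
  have ac: "absolutely_continuous M N"
    unfolding absolutely_continuous_def
  proof
    fix A assume "A \<in> null_sets M"
    hence A: "A \<in> sets M" "emeasure M A = 0" by auto
    with mp have "T -` A \<inter> space M \<in> null_sets M"
      by (auto simp: measure_preserving_def null_sets_def)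
    hence "AE y in M. y \<notin> T -` A \<inter> space M" by (rule AE_not_in)
    hence "(LINT y:T -` A \<inter> space M|M. f y) = 0"
      unfolding set_lebesgue_integral_def
      by (intro integral_eq_zero_AE, elim eventually_mono) (auto simp: indicator_def)
    with N[OF A(1)] A(1) show "A \<in> null_sets N" by (auto simp: null_sets_def sets_N)
  qed
  obtain D where D [measurable]: "D \<in> borel_measurable M"
    and RN: "AE x in M. RN_deriv M N x = ennreal (D x)" and D0: "\<And>x. 0 \<le> D x"
    using real_RN_deriv[OF fin ac sets_N] by blast
  have "density M (\<lambda>x. ennreal (D x)) = density M (RN_deriv M N)"
    using RN by (intro density_cong) (auto elim!: eventually_mono)
  hence dens: "density M (\<lambda>x. ennreal (D x)) = N"
    using density_RN_deriv[OF ac sets_N] by simp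
  have D_eq: "(\<integral>\<^sup>+y. ennreal (indicator A y * D y) \<partial>M) = ennreal (LINT y:T -` A \<inter> space M|M. f y)"
    if A [measurable]: "A \<in> sets M" for A
  proof -
    have "(\<integral>\<^sup>+y. ennreal (indicator A y * D y) \<partial>M) = (\<integral>\<^sup>+y. ennreal (D y) * indicator A y \<partial>M)"
      by (intro nn_integral_cong) (auto split: split_indicator)
    also have "\<dots> = emeasure N A"
      by (simp add: dens[symmetric] emeasure_density)
    finally show ?thesis using N[OF A] by simp
  qed
  have int_D: "integrable M D"
  proof (rule integrableI_nonneg)
    have "(\<integral>\<^sup>+y. ennreal (D y) \<partial>M) = (\<integral>\<^sup>+y. ennreal (indicator (space M) y * D y) \<partial>M)"
      by (intro nn_integral_cong) auto
    thus "(\<integral>\<^sup>+y. ennreal (D y) \<partial>M) < \<infinity>" using D_eq[of "space M"] by simp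
  qed (use D0 in auto)
  have "(LINT y:A|M. D y) = (LINT y:T -` A \<inter> space M|M. f y)" if A [measurable]: "A \<in> sets M" for A
  proof -
    have "(LINT y:A|M. D y) = enn2real (\<integral>\<^sup>+y. ennreal (indicator A y * D y) \<partial>M)"
      unfolding set_lebesgue_integral_def
      using D0 by (subst integral_eq_nn_integral) auto
    also have "\<dots> = (LINT y:T -` A \<inter> space M|M. f y)"
      unfolding D_eq[OF A] set_lebesgue_integral_def
      using f0 by (intro enn2real_ennreal Bochner_Integration.integral_nonneg) auto
    finally show ?thesis .
  qed
  with int_D show ?thesis unfolding is_transfer_def by blast
qed

lemma is_transfer_exists:
  assumes "prob_space M" "measure_preserving M T" and f: "integrable M f"
  shows "\<exists>g. is_transfer M T f g"
proof -
  obtain g where g: "is_transfer M T (\<lambda>y. max 0 (f y)) g"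
    using is_transfer_exists_nonneg[OF assms(1,2), of "\<lambda>y. max 0 (f y)"] f by auto
  obtain g' where g': "is_transfer M T (\<lambda>y. max 0 (- f y)) g'"
    using is_transfer_exists_nonneg[OF assms(1,2), of "\<lambda>y. max 0 (- f y)"] f by auto
  have set_int: "set_integrable M A u" if "integrable M u" "A \<in> sets M" for A and u :: "'a \<Rightarrow> real"
    using integrable_mult_indicator[OF that(2,1)] by (simp add: set_integrable_def)
  have "is_transfer M T f (\<lambda>y. g y - g' y)"
    unfolding is_transfer_def
  proof (intro conjI ballI)
    show "integrable M (\<lambda>y. g y - g' y)"
      using g g' by (simp add: is_transfer_def)
    fix A assume A: "A \<in> sets M"
    have B: "T -` A \<inter> space M \<in> sets M"
      using assms(2) A by (auto simp: measure_preserving_def intro: measurable_sets)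
    have "f = (\<lambda>y. max 0 (f y) - max 0 (- f y))" by (auto simp: max_def)
    hence "(LINT y:T -` A \<inter> space M|M. f y)
        = (LINT y:T -` A \<inter> space M|M. max 0 (f y) - max 0 (- f y))" by metis
    also have "\<dots> = (LINT y:T -` A \<inter> space M|M. max 0 (f y)) - (LINT y:T -` A \<inter> space M|M. max 0 (- f y))"
      using f by (intro set_integral_diff set_int B) auto
    also have "\<dots> = (LINT y:A|M. g y) - (LINT y:A|M. g' y)"
      using g g' A by (simp add: is_transfer_def)
    also have "\<dots> = (LINT y:A|M. g y - g' y)"
      using g g' by (intro set_integral_diff(2)[symmetric] set_int A) (auto simp: is_transfer_def)
    finally show "(LINT y:A|M. g y - g' y) = (LINT y:T -` A \<inter> space M|M. f y)" by simp
  qed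
  thus ?thesis by blast
qed

lemma is_transfer_transfer_op:
  assumes "prob_space M" "measure_preserving M T" "integrable M f"
  shows "is_transfer M T f (transfer_op M T f)"
  unfolding transfer_op_def by (rule someI_ex[OF is_transfer_exists[OF assms]])

text \<open>Here \<open>normal_density 0 \<sigma>\<close> is parametrised by the standard deviation \<open>\<sigma>\<close>.\<close>

definition CLT_holds :: "'a measure \<Rightarrow> ('a \<Rightarrow> 'a) \<Rightarrow> ('a \<Rightarrow> real) \<Rightarrow> bool" where
  "CLT_holds M T h \<longleftrightarrow>
     (\<exists>\<sigma>>0. weak_conv_m
        (\<lambda>n. distr M borel (\<lambda>y. (1 / sqrt (real n)) * (\<Sum>j<n. h ((T ^^ j) y))))
        (density lborel (normal_density 0 \<sigma>)))"

end

theory Submission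
  imports Defs
begin

text \<open>
  Write \<open>U f = f \<circ> T\<close> and let \<open>P\<close> be the transfer operator. On \<open>L\<^sup>2\<close> the operator \<open>P\<close> is the
  adjoint of the isometry \<open>U\<close>, so \<open>P U = 1\<close>, and \<open>U P\<close> is the conditional expectation given
  \<open>T\<^sup>-\<^sup>1\<B>\<close>. If \<open>P d = 0\<close> then \<open>d \<circ> T\<^sup>j\<close> is a stationary sequence of reverse martingale
  differences; in particular its terms are orthogonal and \<open>n\<close> of them have a sum of norm exactly
  \<open>\<surd>n \<parallel>d\<parallel>\<close>. The theorem says that \<open>h\<close> differs from such a \<open>d\<close> by something with Birkhoff sums
  of order \<open>o(\<surd>n)\<close>, and that such a \<open>d\<close> satisfies the central limit theorem when \<open>T\<close> is ergodic.

  \<^bold>\<open>Approximation.\<close> Let \<open>V\<^sub>k = h + P h + \<dots> + P\<^sup>k\<^sup>-\<^sup>1 h\<close> and let \<open>g\<^sub>N\<close> be the average of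
  \<open>V\<^sub>1, \<dots>, V\<^sub>N\<close>. Then \<open>g\<^sub>N\<close> solves the Poisson equation \<open>g - P g = h\<close> up to the small defect
  \<open>P V\<^sub>N / N\<close>. Hence \<open>m\<^sub>N = g\<^sub>N - U P g\<^sub>N\<close>, which lies in the kernel of \<open>P\<close>, differs from \<open>h\<close> by the
  coboundary of \<open>P g\<^sub>N\<close> and this defect, and for \<open>n\<close> comparable to \<open>N\<close> the Birkhoff sums of \<open>h\<close> and
  \<open>m\<^sub>N\<close> differ in norm by at most a multiple of the mean \<open>A\<^sub>N\<close> of \<open>\<parallel>V\<^sub>1\<parallel>, \<dots>, \<parallel>V\<^sub>N\<parallel>\<close>
  (\<open>birkhoff_sum_martingale_part_norm\<close>). It remains to see that \<open>m\<^sub>N\<close> converges along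
  \<open>N = 4\<^sup>j\<close>. By Pythagoras \<open>\<parallel>D - U P D\<parallel>\<^sup>2 = \<parallel>D\<parallel>\<^sup>2 - \<parallel>P D\<parallel>\<^sup>2 \<le> 2 \<parallel>D\<parallel> \<parallel>D - P D\<parallel>\<close>; for a
  difference \<open>D\<close> of two consecutive \<open>g\<^sub>N\<close> the first factor is of order \<open>A\<^sub>N\<close>, while the second only
  contains defects and is of order \<open>A\<^sub>N / N\<close> (\<open>martingale_part_diff_norm\<close>). So consecutive terms are
  at distance of order \<open>A\<^sub>N / \<surd>N\<close>, and these numbers are summable over \<open>N = 4\<^sup>j\<close> because
  \<open>\<Sum> n\<^sup>-\<^sup>3\<^sup>/\<^sup>2 \<parallel>V\<^sub>n\<parallel>\<close> converges (\<open>summable_means_powers_of_four\<close>). The limit is the function sought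
  (\<open>martingale_approximation\<close>).

  \<^bold>\<open>Central limit theorem.\<close> A function \<open>d\<close> with \<open>P d = 0\<close> is an \<open>L\<^sup>2\<close> limit of bounded functions with
  the same property (\<open>kernel_bounded_approximation\<close>), and replacing \<open>d\<close> by \<open>d'\<close> changes the
  normalised sums by \<open>\<parallel>d - d'\<parallel>\<close> in norm, for every \<open>n\<close>. For bounded \<open>d\<close> McLeish's argument applies:
  \<open>exp(i x)\<close> is \<open>(1 + i x) exp(-x\<^sup>2/2)\<close> up to \<open>O(x\<^sup>3)\<close>, the product of the factors \<open>1 + i x\<close> is
  bounded and has expectation exactly \<open>1\<close>, and the sum of the \<open>x\<^sup>2\<close> is an ergodic average of \<open>d\<^sup>2\<close>
  (\<open>clt_bounded_kernel\<close>). The last point uses the mean ergodic theorem (\<open>mean_ergodic_theorem\<close>).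
  Levy's continuity theorem turns the convergence of characteristic functions into weak convergence.
\<close>

section \<open>Square-integrable functions\<close>

lemma square_integrable_bounded_measurable:
  assumes "prob_space M" "f \<in> borel_measurable M" "\<And>y. \<bar>f y\<bar> \<le> C"
  shows "square_integrable M f"
proof -
  interpret prob_space M by fact
  have "(f y)\<^sup>2 \<le> C\<^sup>2" for y using assms(3)[of y] by (metis abs_le_square_iff abs_ge_self order_trans)
  thus ?thesis unfolding square_integrable_def
    using assms(2) by (auto intro!: integrable_const_bound[of _ "C\<^sup>2"])
qed

lemma square_integrable_product:
  assumes "square_integrable M f" "square_integrable M g"
  shows "integrable M (\<lambda>y. f y * g y)"
proof (rule Bochner_Integration.integrable_bound)
  show "integrable M (\<lambda>y. (f y)\<^sup>2 + (g y)\<^sup>2)"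
    using assms by (auto simp: square_integrable_def)
  show "(\<lambda>y. f y * g y) \<in> borel_measurable M"
    using assms by (auto simp: square_integrable_def)
  show "AE y in M. norm (f y * g y) \<le> norm ((f y)\<^sup>2 + (g y)\<^sup>2)"
  proof (rule AE_I2)
    fix y
    have "2 * \<bar>f y\<bar> * \<bar>g y\<bar> \<le> \<bar>f y\<bar>\<^sup>2 + \<bar>g y\<bar>\<^sup>2" by (rule sum_squares_bound)
    moreover have "0 \<le> \<bar>f y\<bar> * \<bar>g y\<bar>" by simp
    ultimately have "\<bar>f y\<bar> * \<bar>g y\<bar> \<le> \<bar>f y\<bar>\<^sup>2 + \<bar>g y\<bar>\<^sup>2" by linarith
    thus "norm (f y * g y) \<le> norm ((f y)\<^sup>2 + (g y)\<^sup>2)"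
      by (simp add: abs_mult)
  qed
qed

lemma square_integrable_add:
  assumes "square_integrable M f" "square_integrable M g"
  shows "square_integrable M (\<lambda>y. f y + g y)"
proof -
  have "integrable M (\<lambda>y. (f y)\<^sup>2 + (g y)\<^sup>2 + 2 * (f y * g y))"
    using assms square_integrable_product[OF assms]
    by (auto simp: square_integrable_def)
  thus ?thesis using assms
    by (auto simp: square_integrable_def power2_sum algebra_simps)
qed

lemma square_integrable_scale:
  "square_integrable M f \<Longrightarrow> square_integrable M (\<lambda>y. c * f y)"
  by (auto simp: square_integrable_def power_mult_distrib)

lemma square_integrable_diff:
  assumes "square_integrable M f" "square_integrable M g"
  shows "square_integrable M (\<lambda>y. f y - g y)"
  using square_integrable_add[OF assms(1) square_integrable_scale[OF assms(2), of "-1"]] by simp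

lemma square_integrable_sum:
  assumes "\<And>i. i \<in> I \<Longrightarrow> square_integrable M (f i)"
  shows "square_integrable M (\<lambda>y. \<Sum>i\<in>I. f i y)"
  using assms
proof (induction I rule: infinite_finite_induct)
  case (insert i I)
  thus ?case using square_integrable_add[of M "f i" "\<lambda>y. \<Sum>i\<in>I. f i y"] by auto
qed (auto simp: square_integrable_def)

lemma L2_norm_nonneg [simp]: "0 \<le> L2_norm M f"
  by (simp add: L2_norm_def)

lemma L2_norm_zero [simp]: "L2_norm M (\<lambda>y. 0) = 0"
  by (simp add: L2_norm_def)

lemma L2_norm_power2: "(L2_norm M f)\<^sup>2 = (\<integral>y. (f y)\<^sup>2 \<partial>M)"
  by (simp add: L2_norm_def)

lemma L2_norm_scale: "L2_norm M (\<lambda>y. c * f y) = \<bar>c\<bar> * L2_norm M f"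
  by (simp add: L2_norm_def power_mult_distrib real_sqrt_mult)

lemma L2_norm_cong_AE:
  assumes "square_integrable M f" "square_integrable M g" "AE y in M. f y = g y"
  shows "L2_norm M f = L2_norm M g"
proof -
  have "(\<integral>y. (f y)\<^sup>2 \<partial>M) = (\<integral>y. (g y)\<^sup>2 \<partial>M)"
    using assms by (intro integral_cong_AE) (auto simp: square_integrable_def)
  thus ?thesis by (simp add: L2_norm_def)
qed

lemma L2_norm_Cauchy_Schwarz:
  assumes f: "square_integrable M f" and g: "square_integrable M g"
  shows "\<bar>\<integral>y. f y * g y \<partial>M\<bar> \<le> L2_norm M f * L2_norm M g"
proof -
  define I where "I = (\<integral>y. \<bar>f y\<bar> * \<bar>g y\<bar> \<partial>M)"
  have [measurable]: "f \<in> borel_measurable M" "g \<in> borel_measurable M"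
    using assms by (auto simp: square_integrable_def)
  have int: "integrable M (\<lambda>y. \<bar>f y\<bar> * \<bar>g y\<bar>)"
    using integrable_abs[OF square_integrable_product[OF assms]] by (simp add: abs_mult)
  have I0: "0 \<le> I" unfolding I_def by (intro integral_nonneg_AE) auto
  have "(\<integral>\<^sup>+y. ennreal \<bar>f y\<bar> * ennreal \<bar>g y\<bar> \<partial>M) = ennreal I"
    unfolding I_def using int by (simp add: ennreal_mult''[symmetric] nn_integral_eq_integral)
  moreover have "(\<integral>\<^sup>+y. (ennreal \<bar>u y\<bar>)\<^sup>2 \<partial>M) = ennreal (\<integral>y. (u y)\<^sup>2 \<partial>M)"
    if "square_integrable M u" for u
    using that by (simp add: ennreal_power nn_integral_eq_integral square_integrable_def)
  ultimately have "(ennreal I)\<^sup>2 \<le> ennreal (\<integral>y. (f y)\<^sup>2 \<partial>M) * ennreal (\<integral>y. (g y)\<^sup>2 \<partial>M)"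
    using Cauchy_Schwarz_nn_integral[of "\<lambda>y. ennreal \<bar>f y\<bar>" M "\<lambda>y. ennreal \<bar>g y\<bar>"] f g by simp
  hence "I\<^sup>2 \<le> (L2_norm M f * L2_norm M g)\<^sup>2"
    using I0 by (simp add: ennreal_power ennreal_mult'[symmetric] power_mult_distrib L2_norm_power2)
  hence "I \<le> L2_norm M f * L2_norm M g"
    by (rule power2_le_imp_le) simp
  moreover have "\<bar>\<integral>y. f y * g y \<partial>M\<bar> \<le> I"
    unfolding I_def abs_mult[symmetric] by (rule integral_abs_bound)
  ultimately show ?thesis by linarith
qed

lemma L2_norm_add_power2:
  assumes "square_integrable M f" "square_integrable M g"
  shows "(L2_norm M (\<lambda>y. f y + g y))\<^sup>2 = (L2_norm M f)\<^sup>2 + (L2_norm M g)\<^sup>2 + 2 * (\<integral>y. f y * g y \<partial>M)"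
proof -
  have "(\<integral>y. (f y + g y)\<^sup>2 \<partial>M) = (\<integral>y. (f y)\<^sup>2 + (g y)\<^sup>2 + 2 * (f y * g y) \<partial>M)"
    by (simp add: power2_sum algebra_simps)
  also have "\<dots> = (\<integral>y. (f y)\<^sup>2 \<partial>M) + (\<integral>y. (g y)\<^sup>2 \<partial>M) + 2 * (\<integral>y. f y * g y \<partial>M)"
    using assms square_integrable_product[OF assms]
    by (simp add: square_integrable_def)
  finally show ?thesis by (simp add: L2_norm_power2)
qed

lemma L2_norm_diff_power2:
  assumes "square_integrable M f" "square_integrable M g"
  shows "(L2_norm M (\<lambda>y. f y - g y))\<^sup>2 = (L2_norm M f)\<^sup>2 + (L2_norm M g)\<^sup>2 - 2 * (\<integral>y. f y * g y \<partial>M)"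
  using L2_norm_add_power2[OF assms(1) square_integrable_scale[OF assms(2), of "-1"]]
    L2_norm_scale[of M "-1" g] by simp

lemma L2_norm_triangle:
  assumes "square_integrable M f" "square_integrable M g"
  shows "L2_norm M (\<lambda>y. f y + g y) \<le> L2_norm M f + L2_norm M g"
proof (rule power2_le_imp_le)
  show "(L2_norm M (\<lambda>y. f y + g y))\<^sup>2 \<le> (L2_norm M f + L2_norm M g)\<^sup>2"
    using L2_norm_add_power2[OF assms] L2_norm_Cauchy_Schwarz[OF assms]
    by (simp add: power2_sum)
qed simp

lemma L2_norm_triangle_diff:
  assumes "square_integrable M f" "square_integrable M g"
  shows "L2_norm M (\<lambda>y. f y - g y) \<le> L2_norm M f + L2_norm M g"
  using L2_norm_triangle[OF assms(1) square_integrable_scale[OF assms(2), of "-1"]]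
    L2_norm_scale[of M "-1" g] by simp

lemma L2_norm_triangle_sum:
  assumes "\<And>i. i \<in> I \<Longrightarrow> square_integrable M (f i)"
  shows "L2_norm M (\<lambda>y. \<Sum>i\<in>I. f i y) \<le> (\<Sum>i\<in>I. L2_norm M (f i))"
  using assms
proof (induction I rule: infinite_finite_induct)
  case (insert i I)
  have "L2_norm M (\<lambda>y. f i y + (\<Sum>i\<in>I. f i y)) \<le> L2_norm M (f i) + L2_norm M (\<lambda>y. \<Sum>i\<in>I. f i y)"
    using insert by (intro L2_norm_triangle square_integrable_sum) auto
  with insert show ?case by auto
qed simp_all

lemma L2_norm_diff_triangle:
  assumes "square_integrable M f" "square_integrable M g" "square_integrable M k"
  shows "L2_norm M (\<lambda>y. f y - k y) \<le> L2_norm M (\<lambda>y. f y - g y) + L2_norm M (\<lambda>y. g y - k y)"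
  using L2_norm_triangle[OF square_integrable_diff[OF assms(1,2)] square_integrable_diff[OF assms(2,3)]]
  by simp

lemma L2_norm_minus_commute: "L2_norm M (\<lambda>y. f y - g y) = L2_norm M (\<lambda>y. g y - f y)"
  by (simp add: L2_norm_def power2_commute)

lemma L2_norm_reverse_triangle:
  assumes "square_integrable M f" "square_integrable M g"
  shows "\<bar>L2_norm M f - L2_norm M g\<bar> \<le> L2_norm M (\<lambda>y. f y - g y)"
  using L2_norm_triangle[OF assms(1) square_integrable_diff[OF assms(2,1)]]
    L2_norm_triangle[OF assms(2) square_integrable_diff[OF assms]]
    L2_norm_minus_commute[of M f g] by simp

lemma (in prob_space) square_integrable_integrable:
  "square_integrable M f \<Longrightarrow> integrable M f"
  by (auto simp: square_integrable_def intro: square_integrable_imp_integrable)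

lemma (in prob_space) expectation_abs_le_L2_norm:
  assumes "square_integrable M f"
  shows "(\<integral>y. \<bar>f y\<bar> \<partial>M) \<le> L2_norm M f"
proof -
  have 1: "square_integrable M (\<lambda>y. \<bar>f y\<bar>)" and 2: "square_integrable M (\<lambda>y. 1)"
    using assms by (auto simp: square_integrable_def)
  have "L2_norm M (\<lambda>y. 1) = 1" by (simp add: L2_norm_def prob_space)
  thus ?thesis using L2_norm_Cauchy_Schwarz[OF 1 2] by (simp add: L2_norm_def)
qed

text \<open>
  The usual completeness argument: the series of absolute differences has finite expectation, so the
  sequence converges almost everywhere, and Fatou's lemma bounds the distance to the pointwise limit
  by the tail of the series.
\<close>

lemma (in prob_space) L2_complete_summable:
  fixes f :: "nat \<Rightarrow> 'a \<Rightarrow> real"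
  assumes f: "\<And>k. square_integrable M (f k)"
    and summ: "summable (\<lambda>k. L2_norm M (\<lambda>y. f (Suc k) y - f k y))"
  shows "\<exists>g. square_integrable M g \<and> (\<lambda>k. L2_norm M (\<lambda>y. f k y - g y)) \<longlonglongrightarrow> 0"
proof -
  define c where "c k = L2_norm M (\<lambda>y. f (Suc k) y - f k y)" for k
  have summ: "summable c" using summ by (simp add: c_def[abs_def])
  have c0: "0 \<le> c k" for k by (simp add: c_def)
  have [measurable]: "f k \<in> borel_measurable M" for k using f by (simp add: square_integrable_def)
  have d: "square_integrable M (\<lambda>y. f (Suc k) y - f k y)" for k
    by (intro square_integrable_diff f)
  define g where "g y = lim (\<lambda>k. f k y)" for y
  have [measurable]: "g \<in> borel_measurable M" unfolding g_def[abs_def] by measurable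
  have "(\<integral>\<^sup>+y. (\<Sum>k. ennreal \<bar>f (Suc k) y - f k y\<bar>) \<partial>M) = (\<Sum>k. \<integral>\<^sup>+y. ennreal \<bar>f (Suc k) y - f k y\<bar> \<partial>M)"
    by (rule nn_integral_suminf) measurable
  also have "\<dots> \<le> (\<Sum>k. ennreal (c k))"
  proof (rule suminf_le)
    fix k
    have "(\<integral>\<^sup>+y. ennreal \<bar>f (Suc k) y - f k y\<bar> \<partial>M) = ennreal (\<integral>y. \<bar>f (Suc k) y - f k y\<bar> \<partial>M)"
      using square_integrable_integrable[OF d] by (intro nn_integral_eq_integral) auto
    also have "\<dots> \<le> ennreal (c k)"
      unfolding c_def by (intro ennreal_leI expectation_abs_le_L2_norm d)
    finally show "(\<integral>\<^sup>+y. ennreal \<bar>f (Suc k) y - f k y\<bar> \<partial>M) \<le> ennreal (c k)" .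
  qed auto
  also have "\<dots> < \<infinity>"
    using suminf_ennreal_eq[OF c0 summable_sums[OF summ]] by simp
  finally have "AE y in M. (\<Sum>k. ennreal \<bar>f (Suc k) y - f k y\<bar>) \<noteq> \<infinity>"
    by (intro nn_integral_PInf_AE) auto
  hence conv: "AE y in M. (\<lambda>k. f k y) \<longlonglongrightarrow> g y"
  proof (elim eventually_mono)
    fix y assume "(\<Sum>k. ennreal \<bar>f (Suc k) y - f k y\<bar>) \<noteq> \<infinity>"
    hence "summable (\<lambda>k. \<bar>f (Suc k) y - f k y\<bar>)"
      by (intro summable_suminf_not_top) auto
    hence "summable (\<lambda>k. f (Suc k) y - f k y)" by (rule summable_rabs_cancel)
    hence "convergent (\<lambda>n. f n y - f 0 y)"
      unfolding summable_iff_convergent by (simp only: sum_lessThan_telescope[of "\<lambda>n. f n y"])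
    hence "convergent (\<lambda>k. f k y)"
      by (simp only: convergent_diff_const_right_iff)
    thus "(\<lambda>k. f k y) \<longlonglongrightarrow> g y" by (simp add: g_def convergent_LIMSEQ_iff)
  qed
  have step: "L2_norm M (\<lambda>y. f (k + m) y - f k y) \<le> (\<Sum>i<m. c (i + k))" for k m
  proof (induction m)
    case (Suc m)
    have "L2_norm M (\<lambda>y. f (k + Suc m) y - f k y)
        \<le> L2_norm M (\<lambda>y. f (k + Suc m) y - f (k + m) y) + L2_norm M (\<lambda>y. f (k + m) y - f k y)"
      by (intro L2_norm_diff_triangle f)
    with Suc show ?case by (simp add: c_def add.commute)
  qed simp
  have tail: "(\<Sum>i<m. c (i + k)) \<le> (\<Sum>i. c (i + k))" for k m
    using summ c0 by (intro sum_le_suminf) (auto simp: summable_iff_shift)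
  have fatou: "(\<integral>\<^sup>+y. ennreal ((f k y - g y)\<^sup>2) \<partial>M) \<le> ennreal ((\<Sum>i. c (i + k))\<^sup>2)" for k
  proof -
    have "(\<integral>\<^sup>+y. ennreal ((f k y - g y)\<^sup>2) \<partial>M)
        = (\<integral>\<^sup>+y. liminf (\<lambda>m. ennreal ((f (k + m) y - f k y)\<^sup>2)) \<partial>M)"
      using conv
    proof (intro nn_integral_cong_AE, elim eventually_mono)
      fix y assume "(\<lambda>k. f k y) \<longlonglongrightarrow> g y"
      hence "(\<lambda>m. f (k + m) y) \<longlonglongrightarrow> g y"
        using LIMSEQ_ignore_initial_segment[of _ _ k] by (simp add: add.commute)
      hence "(\<lambda>m. ennreal ((f (k + m) y - f k y)\<^sup>2)) \<longlonglongrightarrow> ennreal ((g y - f k y)\<^sup>2)"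
        by (intro tendsto_intros)
      thus "ennreal ((f k y - g y)\<^sup>2) = liminf (\<lambda>m. ennreal ((f (k + m) y - f k y)\<^sup>2))"
        unfolding power2_commute[of "f k y" "g y"] by (intro lim_imp_Liminf[symmetric]) simp_all
    qed
    also have "\<dots> \<le> liminf (\<lambda>m. \<integral>\<^sup>+y. ennreal ((f (k + m) y - f k y)\<^sup>2) \<partial>M)"
      by (intro nn_integral_liminf) measurable
    also have "\<dots> \<le> ennreal ((\<Sum>i. c (i + k))\<^sup>2)"
    proof (rule Liminf_le)
      show "\<forall>\<^sub>F m in sequentially. (\<integral>\<^sup>+y. ennreal ((f (k + m) y - f k y)\<^sup>2) \<partial>M) \<le> ennreal ((\<Sum>i. c (i + k))\<^sup>2)"
      proof (rule always_eventually, rule allI)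
        fix m
        have "(\<integral>\<^sup>+y. ennreal ((f (k + m) y - f k y)\<^sup>2) \<partial>M) = ennreal ((L2_norm M (\<lambda>y. f (k + m) y - f k y))\<^sup>2)"
          using square_integrable_diff[OF f f, of "k + m" k]
          by (simp add: L2_norm_power2 nn_integral_eq_integral square_integrable_def)
        also have "\<dots> \<le> ennreal ((\<Sum>i. c (i + k))\<^sup>2)"
          using order_trans[OF step tail] by (intro ennreal_leI power_mono) auto
        finally show "(\<integral>\<^sup>+y. ennreal ((f (k + m) y - f k y)\<^sup>2) \<partial>M) \<le> ennreal ((\<Sum>i. c (i + k))\<^sup>2)" .
      qed
    qed simp
    finally show ?thesis .
  qed
  have sq: "square_integrable M (\<lambda>y. f k y - g y)" for k
    unfolding square_integrable_def
  proof (intro conjI integrableI_nonneg)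
    show "(\<integral>\<^sup>+y. ennreal ((f k y - g y)\<^sup>2) \<partial>M) < \<infinity>"
      using fatou[of k] by (rule order_le_less_trans) simp
  qed auto
  have g: "square_integrable M g"
    using square_integrable_diff[OF f sq, of 0 0] by simp
  have bound: "L2_norm M (\<lambda>y. f k y - g y) \<le> (\<Sum>i. c (i + k))" for k
  proof (rule power2_le_imp_le)
    have "ennreal ((L2_norm M (\<lambda>y. f k y - g y))\<^sup>2) \<le> ennreal ((\<Sum>i. c (i + k))\<^sup>2)"
      using fatou[of k] sq[of k] by (simp add: L2_norm_power2 nn_integral_eq_integral square_integrable_def)
    thus "(L2_norm M (\<lambda>y. f k y - g y))\<^sup>2 \<le> (\<Sum>i. c (i + k))\<^sup>2" by simp
    show "0 \<le> (\<Sum>i. c (i + k))"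
      using summ c0 by (intro suminf_nonneg) (auto simp: summable_iff_shift)
  qed
  have "(\<lambda>k. \<Sum>i. c (i + k)) \<longlonglongrightarrow> 0" by (rule suminf_exist_split2[OF summ])
  hence "(\<lambda>k. L2_norm M (\<lambda>y. f k y - g y)) \<longlonglongrightarrow> 0"
    by (rule tendsto_sandwich[OF _ _ tendsto_const, rotated 2]) (use bound in auto)
  with g show ?thesis by blast
qed

section \<open>Measure-preserving maps and their transfer operators\<close>

lemma measure_preserving_funpow:
  assumes "measure_preserving M T"
  shows "measure_preserving M (T ^^ n)"
proof (induction n)
  case 0
  have "(\<lambda>x. x) -` A \<inter> space M = A" if "A \<in> sets M" for A
    using sets.sets_into_space[OF that] by auto
  thus ?case by (simp add: measure_preserving_def id_def)
next
  case (Suc n)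
  have T: "T \<in> measurable M M" and Tn: "T ^^ n \<in> measurable M M"
    using assms Suc by (auto simp: measure_preserving_def)
  have [simp]: "(T ^^ Suc n) -` A \<inter> space M = (T ^^ n) -` (T -` A \<inter> space M) \<inter> space M" for A
    using measurable_space[OF Tn] by auto
  note funpow.simps [simp del] vimage_Int [simp del]
  moreover have "T ^^ Suc n \<in> measurable M M"
    unfolding funpow.simps(2) by (rule measurable_comp[OF Tn T])
  ultimately show ?case
    using assms Suc measurable_sets[OF T] unfolding measure_preserving_def by simp
qed

lemma measure_preserving_measurable [measurable_dest]:
  "measure_preserving M T \<Longrightarrow> T \<in> measurable M M"
  by (simp add: measure_preserving_def)

lemma measure_preserving_distr:
  assumes "measure_preserving M T"
  shows "distr M M T = M"
  using assms by (intro measure_eqI) (auto simp: measure_preserving_def emeasure_distr)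

lemma measure_preserving_AE:
  assumes "measure_preserving M T" "AE y in M. P y"
  shows "AE y in M. P (T y)"
proof -
  have "AE y in distr M M T. P y"
    unfolding measure_preserving_distr[OF assms(1)] by (rule assms(2))
  thus ?thesis by (rule AE_distrD[OF measure_preserving_measurable[OF assms(1)]])
qed

lemma measure_preserving_integrable:
  fixes f :: "'a \<Rightarrow> 'b::{banach, second_countable_topology}"
  assumes "measure_preserving M T" "integrable M f"
  shows "integrable M (\<lambda>y. f (T y))"
  using integrable_distr[OF measure_preserving_measurable[OF assms(1)], of f] assms
  by (simp add: measure_preserving_distr)

lemma measure_preserving_integral:
  fixes f :: "'a \<Rightarrow> 'b::{banach, second_countable_topology}"
  assumes "measure_preserving M T" "f \<in> borel_measurable M"
  shows "(\<integral>y. f (T y) \<partial>M) = (\<integral>y. f y \<partial>M)"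
  using integral_distr[OF measure_preserving_measurable[OF assms(1)] assms(2)] assms(1)
  by (simp add: measure_preserving_distr)

lemma measure_preserving_square_integrable:
  assumes "measure_preserving M T" "square_integrable M f"
  shows "square_integrable M (\<lambda>y. f (T y))"
  using assms measure_preserving_integrable[OF assms(1), of "\<lambda>y. (f y)\<^sup>2"]
  by (auto simp: square_integrable_def measure_preserving_def)

lemma measure_preserving_L2_norm:
  assumes "measure_preserving M T" "square_integrable M f"
  shows "L2_norm M (\<lambda>y. f (T y)) = L2_norm M f"
  using assms measure_preserving_integral[OF assms(1), of "\<lambda>y. (f y)\<^sup>2"]
  by (auto simp: square_integrable_def L2_norm_def)

locale measure_preserving_system = prob_space M for M :: "'a measure" +
  fixes T :: "'a \<Rightarrow> 'a"
  assumes mp: "measure_preserving M T"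
begin

lemma measurable_funpow [measurable]: "T ^^ n \<in> measurable M M" "T \<in> measurable M M"
  using mp measure_preserving_funpow[OF mp, of n] by (auto simp: measure_preserving_def)

lemma square_integrable_funpow:
  "square_integrable M f \<Longrightarrow> square_integrable M (\<lambda>y. f ((T ^^ n) y))"
  by (rule measure_preserving_square_integrable[OF measure_preserving_funpow[OF mp]])

lemma L2_norm_funpow:
  "square_integrable M f \<Longrightarrow> L2_norm M (\<lambda>y. f ((T ^^ n) y)) = L2_norm M f"
  by (rule measure_preserving_L2_norm[OF measure_preserving_funpow[OF mp]])

lemma square_integrable_birkhoff_sum:
  "square_integrable M f \<Longrightarrow> square_integrable M (\<lambda>y. \<Sum>j<n. f ((T ^^ j) y))"
  by (intro square_integrable_sum square_integrable_funpow)

lemma L2_norm_birkhoff_sum_le: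
  assumes "square_integrable M f"
  shows "L2_norm M (\<lambda>y. \<Sum>j<n. f ((T ^^ j) y)) \<le> n * L2_norm M f"
  using L2_norm_triangle_sum[of "{..<n}" M "\<lambda>j y. f ((T ^^ j) y)"] square_integrable_funpow[OF assms]
  by (simp add: L2_norm_funpow[OF assms])

lemma is_transfer_integrable: "is_transfer M T f g \<Longrightarrow> integrable M g"
  by (simp add: is_transfer_def)

lemma is_transfer_add:
  assumes "is_transfer M T f g" "is_transfer M T f' g'" "integrable M f" "integrable M f'"
  shows "is_transfer M T (\<lambda>y. f y + f' y) (\<lambda>y. g y + g' y)"
  unfolding is_transfer_def
proof (intro conjI ballI)
  show "integrable M (\<lambda>y. g y + g' y)" using assms by (simp add: is_transfer_def)
  have set_int: "set_integrable M A u" if "integrable M u" "A \<in> sets M" for A and u :: "'a \<Rightarrow> real"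
    using integrable_mult_indicator[OF that(2,1)] by (simp add: set_integrable_def)
  fix A assume A: "A \<in> sets M"
  hence B: "T -` A \<inter> space M \<in> sets M" by simp
  show "(LINT y:A|M. g y + g' y) = (LINT y:T -` A \<inter> space M|M. f y + f' y)"
    using assms A B by (simp add: set_integral_add(2) set_int is_transfer_def)
qed

lemma is_transfer_scale:
  assumes "is_transfer M T f g"
  shows "is_transfer M T (\<lambda>y. c * f y) (\<lambda>y. c * g y)"
  using assms unfolding is_transfer_def by auto

lemma is_transfer_diff:
  assumes "is_transfer M T f g" "is_transfer M T f' g'" "integrable M f" "integrable M f'"
  shows "is_transfer M T (\<lambda>y. f y - f' y) (\<lambda>y. g y - g' y)"
  using is_transfer_add[OF assms(1) is_transfer_scale[OF assms(2), of "-1"]] assms(3,4) by simp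

lemma is_transfer_zero: "is_transfer M T (\<lambda>y. 0) (\<lambda>y. 0)"
  by (simp add: is_transfer_def)

lemma is_transfer_sum:
  assumes "\<And>i. i \<in> I \<Longrightarrow> is_transfer M T (f i) (g i)" "\<And>i. i \<in> I \<Longrightarrow> integrable M (f i)"
  shows "is_transfer M T (\<lambda>y. \<Sum>i\<in>I. f i y) (\<lambda>y. \<Sum>i\<in>I. g i y)"
  using assms
proof (induction I rule: infinite_finite_induct)
  case (insert i I)
  thus ?case by (auto intro!: is_transfer_add Bochner_Integration.integrable_sum)
qed (simp_all add: is_transfer_zero)

lemma is_transfer_cong_AE:
  assumes "is_transfer M T f g" "g' \<in> borel_measurable M" "AE y in M. g y = g' y"
  shows "is_transfer M T f g'"
proof -
  have [measurable]: "g \<in> borel_measurable M" "g' \<in> borel_measurable M"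
    using assms by (auto simp: is_transfer_def)
  have "integrable M g'"
    using assms by (subst integrable_cong_AE[of _ _ g]) (auto simp: is_transfer_def)
  moreover have "(LINT y:A|M. g' y) = (LINT y:A|M. g y)" if [measurable]: "A \<in> sets M" for A
    unfolding set_lebesgue_integral_def
    by (rule integral_cong_AE; (measurable)?) (use assms(3) in \<open>auto elim!: eventually_mono\<close>)
  ultimately show ?thesis using assms(1) by (simp add: is_transfer_def)
qed

text \<open>
  This is the identity \<open>P U = 1\<close>, that is, invariance of the measure.
\<close>

lemma is_transfer_koopman:
  assumes "integrable M g"
  shows "is_transfer M T (\<lambda>y. g (T y)) g"
  unfolding is_transfer_def
proof (intro conjI ballI assms)
  fix A assume [measurable]: "A \<in> sets M"
  have [measurable]: "g \<in> borel_measurable M" using assms by simp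
  have "(LINT y:A|M. g y) = (\<integral>y. indicator A (T y) *\<^sub>R g (T y) \<partial>M)"
    unfolding set_lebesgue_integral_def by (subst measure_preserving_integral[OF mp]) auto
  also have "\<dots> = (LINT y:T -` A \<inter> space M|M. g (T y))"
    unfolding set_lebesgue_integral_def
    by (intro Bochner_Integration.integral_cong) (auto split: split_indicator)
  finally show "(LINT y:A|M. g y) = (LINT y:T -` A \<inter> space M|M. g (T y))" .
qed

definition preimage_algebra :: "'a measure" where
  "preimage_algebra = vimage_algebra (space M) T M"

lemma T_space: "T \<in> space M \<rightarrow> space M"
  using measurable_space[OF measurable_funpow(2)] by auto

lemma subalgebra_preimage: "subalgebra M preimage_algebra"
  unfolding subalgebra_def preimage_algebra_def
  using sets_vimage_algebra2[OF T_space] by auto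

sublocale preimage: finite_measure_subalgebra M preimage_algebra
  by unfold_locales (rule subalgebra_preimage)

lemma measurable_koopman_preimage:
  assumes "g \<in> borel_measurable M"
  shows "(\<lambda>y. g (T y)) \<in> borel_measurable preimage_algebra"
  unfolding preimage_algebra_def
  by (rule measurable_compose[OF measurable_vimage_algebra1[OF T_space] assms])

text \<open>
  This is the identity \<open>U P = E[\<cdot> | T\<^sup>-\<^sup>1\<B>]\<close>. It transfers Jensen's inequality and the pull-out
  property of conditional expectations to the transfer operator.
\<close>

lemma is_transfer_cond_exp:
  assumes "integrable M f" and tr: "is_transfer M T f g"
  shows "AE y in M. real_cond_exp M preimage_algebra f y = g (T y)"
proof (rule preimage.real_cond_exp_charact[OF _ assms(1)])
  have g: "integrable M g" using tr by (simp add: is_transfer_def)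
  show "integrable M (\<lambda>y. g (T y))" by (rule measure_preserving_integrable[OF mp g])
  show "(\<lambda>y. g (T y)) \<in> borel_measurable preimage_algebra"
    using g by (intro measurable_koopman_preimage) auto
  fix A assume "A \<in> sets preimage_algebra"
  then obtain B where B: "B \<in> sets M" "A = T -` B \<inter> space M"
    unfolding preimage_algebra_def sets_vimage_algebra2[OF T_space] by auto
  thus "(LINT y:A|M. f y) = (LINT y:A|M. g (T y))"
    using tr is_transfer_koopman[OF g] by (auto simp: is_transfer_def)
qed

lemma is_transfer_square_integrable:
  assumes f: "square_integrable M f" and tr: "is_transfer M T f g"
  shows "square_integrable M g"
proof -
  note fi = square_integrable_integrable[OF f]
  have [measurable]: "g \<in> borel_measurable M" using tr by (auto simp: is_transfer_def)
  have "integrable M (\<lambda>y. (real_cond_exp M preimage_algebra f y)\<^sup>2)"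
    using fi f convex_power2 by (intro preimage.integrable_convex_cond_exp[where I=UNIV])
      (auto simp: square_integrable_def emeasure_space_1)
  hence "integrable M (\<lambda>y. (g (T y))\<^sup>2)"
    using is_transfer_cond_exp[OF fi tr]
    by (subst (asm) integrable_cong_AE[where g="\<lambda>y. (g (T y))\<^sup>2"]) (auto elim!: eventually_mono)
  hence "integrable (distr M M T) (\<lambda>y. (g y)\<^sup>2)"
    by (subst integrable_distr_eq) auto
  thus ?thesis by (simp add: square_integrable_def measure_preserving_distr[OF mp])
qed

text \<open>
  On \<open>L\<^sup>2\<close> the transfer operator is the adjoint of composition with \<open>T\<close>.
\<close>

lemma is_transfer_adjoint:
  assumes f: "square_integrable M f" and tr: "is_transfer M T f g" and \<phi>: "square_integrable M \<phi>"
  shows "(\<integral>y. f y * \<phi> (T y) \<partial>M) = (\<integral>y. g y * \<phi> y \<partial>M)"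
proof -
  note fi = square_integrable_integrable[OF f]
  have g: "g \<in> borel_measurable M" using tr by (auto simp: is_transfer_def)
  have \<phi>m: "\<phi> \<in> borel_measurable M" using \<phi> by (auto simp: square_integrable_def)
  note [measurable] = g \<phi>m
  have "(\<integral>y. \<phi> (T y) * f y \<partial>M) = (\<integral>y. \<phi> (T y) * real_cond_exp M preimage_algebra f y \<partial>M)"
    using square_integrable_product[OF measure_preserving_square_integrable[OF mp \<phi>] f] f
    by (intro preimage.real_cond_exp_intg(2)[symmetric] measurable_koopman_preimage \<phi>m)
      (auto simp: square_integrable_def)
  also have "\<dots> = (\<integral>y. \<phi> (T y) * g (T y) \<partial>M)"
    using is_transfer_cond_exp[OF fi tr] by (intro integral_cong_AE) (auto elim!: eventually_mono)
  also have "\<dots> = (\<integral>y. \<phi> y * g y \<partial>M)"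
    by (intro measure_preserving_integral[OF mp, of "\<lambda>y. \<phi> y * g y"]) simp
  finally show ?thesis by (simp add: mult.commute)
qed

text \<open>
  Pythagoras: \<open>U P\<close> is an orthogonal projection and \<open>U\<close> is an isometry.
\<close>

lemma is_transfer_residual_norm:
  assumes f: "square_integrable M f" and tr: "is_transfer M T f g"
  shows "(L2_norm M (\<lambda>y. f y - g (T y)))\<^sup>2 = (L2_norm M f)\<^sup>2 - (L2_norm M g)\<^sup>2"
proof -
  note g = is_transfer_square_integrable[OF f tr]
  have "(\<integral>y. f y * g (T y) \<partial>M) = (L2_norm M g)\<^sup>2"
    unfolding is_transfer_adjoint[OF f tr g] L2_norm_power2 by (simp add: power2_eq_square)
  thus ?thesis
    using L2_norm_diff_power2[OF f measure_preserving_square_integrable[OF mp g]]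
      measure_preserving_L2_norm[OF mp g] by simp
qed

lemma is_transfer_contraction:
  assumes "square_integrable M f" "is_transfer M T f g"
  shows "L2_norm M g \<le> L2_norm M f"
proof (rule power2_le_imp_le)
  show "(L2_norm M g)\<^sup>2 \<le> (L2_norm M f)\<^sup>2"
    using is_transfer_residual_norm[OF assms]
      zero_le_power2[of "L2_norm M (\<lambda>y. f y - g (T y))"] by linarith
qed simp

text \<open>
  Since \<open>P U = 1\<close>, the range of \<open>1 - U P\<close> lies in the kernel of \<open>P\<close>; all martingale differences
  below are produced in this way.
\<close>

lemma is_transfer_residual:
  assumes "square_integrable M f" "is_transfer M T f g"
  shows "is_transfer M T (\<lambda>y. f y - g (T y)) (\<lambda>y. 0)"
  using is_transfer_diff[OF assms(2) is_transfer_koopman[of g]] assms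
    measure_preserving_integrable[OF mp, of g]
  by (simp add: is_transfer_integrable square_integrable_integrable)

lemma transfer_op_square_integrable:
  assumes "square_integrable M f"
  shows "is_transfer M T f (transfer_op M T f)" "square_integrable M (transfer_op M T f)"
proof -
  show tr: "is_transfer M T f (transfer_op M T f)"
    using prob_space_axioms by (intro is_transfer_transfer_op mp square_integrable_integrable assms)
  show "square_integrable M (transfer_op M T f)"
    by (rule is_transfer_square_integrable[OF assms tr])
qed

text \<open>
  A conditional expectation stays within the bounds of the function, but only almost everywhere;
  clipping the representative makes the bound hold everywhere.
\<close>

lemma is_transfer_bounded:
  assumes "f \<in> borel_measurable M" "\<And>y. \<bar>f y\<bar> \<le> C"
  obtains g where "is_transfer M T f g" "\<And>y. \<bar>g y\<bar> \<le> C"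
proof -
  have f: "square_integrable M f"
    by (rule square_integrable_bounded_measurable[OF prob_space_axioms assms])
  note fi = square_integrable_integrable[OF f]
  define g where "g = transfer_op M T f"
  note tr = transfer_op_square_integrable(1)[OF f, folded g_def]
  have [measurable]: "g \<in> borel_measurable M" using tr by (auto simp: is_transfer_def)
  have C: "- C \<le> f y" "f y \<le> C" for y using assms(2)[of y] by auto
  have "AE y in M. - C \<le> g (T y) \<and> g (T y) \<le> C"
    using preimage.real_cond_exp_ge_c[OF fi, of "- C"] preimage.real_cond_exp_le_c[OF fi, of C]
      is_transfer_cond_exp[OF fi tr] C by (auto elim!: eventually_elim2)
  hence "AE y in distr M M T. - C \<le> g y \<and> g y \<le> C"
    by (subst AE_distr_iff) auto
  hence "AE y in M. - C \<le> g y \<and> g y \<le> C"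
    unfolding measure_preserving_distr[OF mp] .
  hence "AE y in M. g y = max (- C) (min C (g y))"
    by (elim eventually_mono) auto
  hence "is_transfer M T f (\<lambda>y. max (- C) (min C (g y)))"
    by (intro is_transfer_cong_AE[OF tr]) auto
  moreover have "\<bar>max (- C) (min C (g y))\<bar> \<le> C" for y
    using assms(2)[of undefined] by (auto simp: max_def min_def)
  ultimately show ?thesis by (rule that)
qed

end

section \<open>Subadditive sequences\<close>

text \<open>
  Pair \<open>k\<close> with \<open>N - k\<close>: each pair sums to at least \<open>a N\<close>. This lets means of the sequence
  control its individual terms, for which the hypothesis gives no direct bound.
\<close>

lemma subadditive_le_mean:
  fixes a :: "nat \<Rightarrow> real"
  assumes sub: "\<And>m n. a (m + n) \<le> a m + a n" and nonneg: "\<And>n. 0 \<le> a n"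
  shows "real N * a N \<le> 2 * (\<Sum>k=1..N. a k)"
proof (cases N)
  case (Suc m)
  have "(\<Sum>k=1..m. a N) \<le> (\<Sum>k=1..m. a k + a (N - k))"
  proof (rule sum_mono)
    fix k assume "k \<in> {1..m}"
    hence "k + (N - k) = N" using Suc by simp
    thus "a N \<le> a k + a (N - k)" using sub[of k "N - k"] by simp
  qed
  also have "\<dots> = (\<Sum>k=1..m. a k) + (\<Sum>k=1..m. a (N - k))"
    by (rule sum.distrib)
  also have "(\<Sum>k=1..m. a (N - k)) = (\<Sum>k=1..m. a k)"
    by (rule sum.reindex_bij_witness[of _ "\<lambda>k. N - k" "\<lambda>k. N - k"]) (auto simp: Suc)
  finally have "real m * a N \<le> 2 * (\<Sum>k=1..m. a k)" by simp
  thus ?thesis using Suc nonneg[of N] by (simp add: algebra_simps)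
qed simp

text \<open>
  With the mean \<open>A\<^sub>N = (a\<^sub>1 + \<dots> + a\<^sub>N) / N\<close>, the terms are \<open>A\<^sub>N / \<surd>N\<close> for \<open>N = 4\<^sup>j\<close>.
  After exchanging the sums, \<open>a\<^sub>k\<close> is multiplied by the sum of \<open>8\<^sup>-\<^sup>j\<close> over \<open>4\<^sup>j \<ge> k\<close>, a geometric
  tail of order \<open>k\<^sup>-\<^sup>3\<^sup>/\<^sup>2\<close>. Powers of four keep the square roots integral.
\<close>

lemma summable_means_powers_of_four:
  fixes a :: "nat \<Rightarrow> real"
  assumes nonneg: "\<And>n. 0 \<le> a n"
    and summ: "summable (\<lambda>m. real (Suc m) powr (- 3 / 2) * a (Suc m))"
  shows "summable (\<lambda>j. (\<Sum>k=1..4 ^ j. a k) / 8 ^ j)"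
proof (rule summableI_nonneg_bounded)
  define c where "c m = real (Suc m) powr (- 3 / 2) * a (Suc m)" for m
  have c0: "0 \<le> c m" for m using nonneg by (simp add: c_def)
  have geo: "(\<Sum>j | j < n \<and> k \<le> 4 ^ j. (1/8 :: real) ^ j) \<le> 2 * real k powr (- 3 / 2)"
    if k: "0 < k" for k n :: nat
  proof (cases "\<exists>j. j < n \<and> k \<le> 4 ^ j")
    case True
    define j0 where "j0 = (LEAST j. j < n \<and> k \<le> 4 ^ j)"
    have j0: "k \<le> 4 ^ j0"
      using LeastI_ex[OF True] by (simp add: j0_def)
    have least: "j0 \<le> j" if "j < n" "k \<le> 4 ^ j" for j
      unfolding j0_def using that by (intro Least_le) simp
    have "(1/8 :: real) ^ j0 \<le> real k powr (- 3 / 2)"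
    proof -
      have "(real (4 ^ j0)) powr (- 3 / 2) \<le> real k powr (- 3 / 2)"
        using j0 k by (intro powr_mono2') (auto simp del: of_nat_power)
      moreover have "real (4 ^ j0) powr (- 3 / 2) = (1/8) ^ j0"
      proof -
        have "real (4 ^ j0) = 2 ^ (2 * j0)" by (simp add: power_mult)
        also have "\<dots> = 2 powr real (2 * j0)" by (rule powr_realpow[symmetric]) simp
        finally have "real (4 ^ j0) powr (- 3 / 2) = 2 powr (- real (3 * j0))"
          by (simp only: powr_powr) simp
        also have "\<dots> = inverse (2 ^ (3 * j0))"
          by (simp only: powr_minus powr_realpow)
        also have "\<dots> = (1/8) ^ j0" by (simp add: power_mult power_divide divide_simps)
        finally show ?thesis .
      qed
      ultimately show ?thesis by simp
    qed
    have "(\<Sum>j | j < n \<and> k \<le> 4 ^ j. (1/8 :: real) ^ j) \<le> (\<Sum>j\<in>{j0..<j0 + n}. (1/8) ^ j)"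
      using least by (intro sum_mono2) auto
    also have "\<dots> = (1/8) ^ j0 * (\<Sum>j<n. (1/8) ^ j)"
      using sum.shift_bounds_nat_ivl[of "\<lambda>j. (1/8 :: real) ^ j" 0 j0 n]
      by (simp add: sum_distrib_left power_add atLeast0LessThan add.commute mult.commute)
    also have "\<dots> \<le> (1/8) ^ j0 * 2"
    proof (rule mult_left_mono)
      have "(\<Sum>j<n. (1/8 :: real) ^ j) = (1 - (1/8) ^ n) / (7/8)"
        by (subst sum_gp_strict) auto
      also have "\<dots> \<le> 1 / (7/8)" by (intro divide_right_mono) auto
      finally show "(\<Sum>j<n. (1/8 :: real) ^ j) \<le> 2" by simp
    qed simp
    finally show ?thesis using \<open>(1/8 :: real) ^ j0 \<le> real k powr (- 3 / 2)\<close> by simp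
  next
    case False
    hence "{j. j < n \<and> k \<le> 4 ^ j} = {}" by blast
    thus ?thesis by (simp only: sum.empty) simp
  qed
  show "0 \<le> (\<Sum>k=1..4 ^ j. a k) / 8 ^ j" for j
    using nonneg by (simp add: sum_nonneg)
  fix n
  have "(\<Sum>j<n. (\<Sum>k=1..4 ^ j. a k) / 8 ^ j) = (\<Sum>j<n. \<Sum>k | k \<in> {1..4 ^ n} \<and> k \<le> 4 ^ j. a k * (1/8) ^ j)"
  proof (intro sum.cong refl)
    fix j assume "j \<in> {..<n}"
    hence le: "(4::nat) ^ j \<le> 4 ^ n" by (intro power_increasing) auto
    have "{k::nat. k \<in> {1..4 ^ n} \<and> k \<le> 4 ^ j} = {1..4 ^ j}"
      by (auto intro: order_trans[OF _ le])
    thus "(\<Sum>k=1..4 ^ j. a k) / 8 ^ j = (\<Sum>k | k \<in> {1..4 ^ n} \<and> k \<le> 4 ^ j. a k * (1/8) ^ j)"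
      by (simp add: sum_divide_distrib power_divide)
  qed
  also have "\<dots> = (\<Sum>k\<in>{1..4 ^ n}. \<Sum>j | j \<in> {..<n} \<and> k \<le> 4 ^ j. a k * (1/8) ^ j)"
    by (rule sum.swap_restrict) auto
  also have "\<dots> = (\<Sum>k\<in>{1..4 ^ n}. a k * (\<Sum>j | j < n \<and> k \<le> 4 ^ j. (1/8) ^ j))"
    by (simp add: sum_distrib_left)
  also have "\<dots> \<le> (\<Sum>k\<in>{1..4 ^ n}. a k * (2 * real k powr (- 3 / 2)))"
    using geo nonneg by (intro sum_mono mult_left_mono) auto
  also have "\<dots> = (\<Sum>m<4 ^ n. 2 * c m)"
    by (rule sum.reindex_bij_witness[of _ Suc "\<lambda>k. k - 1"]) (auto simp: c_def)
  also have "\<dots> = 2 * (\<Sum>m<4 ^ n. c m)" by (simp add: sum_distrib_left)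
  also have "\<dots> \<le> 2 * (\<Sum>m. c m)"
    using summ c0 by (intro mult_left_mono sum_le_suminf) (auto simp: c_def[abs_def])
  finally show "(\<Sum>j<n. (\<Sum>k=1..4 ^ j. a k) / 8 ^ j) \<le> 2 * (\<Sum>m. c m)" .
qed

section \<open>Martingale approximation\<close>

context measure_preserving_system
begin

text \<open>
  Orthogonality of martingale differences: peeling off the first term \<open>d\<close> leaves a function of
  \<open>T y\<close>, and \<open>d\<close> is orthogonal to those because \<open>P d = 0\<close>.
\<close>

lemma L2_norm_birkhoff_sum_kernel:
  assumes d: "square_integrable M d" and tr: "is_transfer M T d (\<lambda>y. 0)"
  shows "L2_norm M (\<lambda>y. \<Sum>j<n. d ((T ^^ j) y)) = sqrt n * L2_norm M d"
proof -
  have "(L2_norm M (\<lambda>y. \<Sum>j<n. d ((T ^^ j) y)))\<^sup>2 = n * (L2_norm M d)\<^sup>2"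
  proof (induction n)
    case (Suc n)
    define G where "G y = (\<Sum>j<n. d ((T ^^ j) y))" for y
    have G: "square_integrable M G"
      unfolding G_def[abs_def] by (rule square_integrable_birkhoff_sum[OF d])
    have "(\<Sum>j<Suc n. d ((T ^^ j) y)) = d y + G (T y)" for y
      unfolding G_def sum.lessThan_Suc_shift by (simp add: funpow_swap1)
    hence "(L2_norm M (\<lambda>y. \<Sum>j<Suc n. d ((T ^^ j) y)))\<^sup>2
        = (L2_norm M d)\<^sup>2 + (L2_norm M (\<lambda>y. G (T y)))\<^sup>2 + 2 * (\<integral>y. d y * G (T y) \<partial>M)"
      using L2_norm_add_power2[OF d measure_preserving_square_integrable[OF mp G]] by simp
    also have "(\<integral>y. d y * G (T y) \<partial>M) = 0"
      using is_transfer_adjoint[OF d tr G] by simp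
    also have "L2_norm M (\<lambda>y. G (T y)) = L2_norm M G"
      by (rule measure_preserving_L2_norm[OF mp G])
    finally show ?case using Suc by (simp add: G_def[abs_def] algebra_simps)
  qed simp
  also have "\<dots> = (sqrt n * L2_norm M d)\<^sup>2" by (simp add: power_mult_distrib)
  finally show ?thesis by (simp add: power2_eq_iff_nonneg)
qed

end

locale observable = measure_preserving_system +
  fixes h :: "'a \<Rightarrow> real"
  assumes h: "square_integrable M h"
begin

definition partial_sum :: "nat \<Rightarrow> 'a \<Rightarrow> real" where
  "partial_sum n y = (\<Sum>k<n. (transfer_op M T ^^ k) h y)"

definition cesaro :: "nat \<Rightarrow> 'a \<Rightarrow> real" where
  "cesaro N y = (1 / real N) * (\<Sum>k=1..N. partial_sum k y)"

text \<open>
  This is \<open>P\<close> applied to \<open>cesaro N\<close>, written with \<open>P V\<^sub>k = V\<^sub>k\<^sub>+\<^sub>1 - h\<close>. The choice of this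
  representative makes the identities below hold at every point and not just almost everywhere.
\<close>

definition cesaro_transfer :: "nat \<Rightarrow> 'a \<Rightarrow> real" where
  "cesaro_transfer N y = (1 / real N) * (\<Sum>k=1..N. partial_sum (Suc k) y - h y)"

definition martingale_part :: "nat \<Rightarrow> 'a \<Rightarrow> real" where
  "martingale_part N y = cesaro N y - cesaro_transfer N (T y)"

definition mean_norm :: "nat \<Rightarrow> real" where
  "mean_norm N = (\<Sum>k=1..N. L2_norm M (partial_sum k)) / real N"

lemma transfer_iterate_square_integrable: "square_integrable M ((transfer_op M T ^^ k) h)"
  by (induction k) (auto simp: h transfer_op_square_integrable(2))

lemma transfer_iterate_Suc:
  "is_transfer M T ((transfer_op M T ^^ k) h) ((transfer_op M T ^^ Suc k) h)"
  using transfer_op_square_integrable(1)[OF transfer_iterate_square_integrable] by simp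

lemma partial_sum_square_integrable: "square_integrable M (partial_sum n)"
  unfolding partial_sum_def[abs_def]
  by (intro square_integrable_sum transfer_iterate_square_integrable)

lemma partial_sum_transfer: "is_transfer M T (partial_sum n) (\<lambda>y. partial_sum (Suc n) y - h y)"
proof -
  have "is_transfer M T (partial_sum n) (\<lambda>y. \<Sum>k<n. (transfer_op M T ^^ Suc k) h y)"
    unfolding partial_sum_def[abs_def]
    by (intro is_transfer_sum transfer_iterate_Suc square_integrable_integrable
        transfer_iterate_square_integrable)
  moreover have "partial_sum (Suc n) y - h y = (\<Sum>k<n. (transfer_op M T ^^ Suc k) h y)" for y
    unfolding partial_sum_def sum.lessThan_Suc_shift by simp
  ultimately show ?thesis by simp
qed

text \<open>
  Because \<open>V\<^sub>m\<^sub>+\<^sub>n = V\<^sub>m + P\<^sup>m V\<^sub>n\<close> and \<open>P\<close> is a contraction.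
\<close>

lemma partial_sum_subadditive:
  "L2_norm M (partial_sum (m + n)) \<le> L2_norm M (partial_sum m) + L2_norm M (partial_sum n)"
proof -
  define shifted where "shifted m y = (\<Sum>k<n. (transfer_op M T ^^ (m + k)) h y)" for m y
  have sq: "square_integrable M (shifted m)" for m
    unfolding shifted_def[abs_def]
    by (intro square_integrable_sum transfer_iterate_square_integrable)
  have "is_transfer M T (shifted m) (shifted (Suc m))" for m
    unfolding shifted_def[abs_def] add_Suc
    by (intro is_transfer_sum transfer_iterate_Suc square_integrable_integrable
        transfer_iterate_square_integrable)
  hence "L2_norm M (shifted (Suc m)) \<le> L2_norm M (shifted m)" for m
    by (rule is_transfer_contraction[OF sq])
  hence "L2_norm M (shifted m) \<le> L2_norm M (shifted 0)"
    by (rule lift_Suc_antimono_le) simp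
  moreover have "shifted 0 = partial_sum n"
    by (simp add: shifted_def[abs_def] partial_sum_def[abs_def])
  moreover have "partial_sum (m + n) = (\<lambda>y. partial_sum m y + shifted m y)"
  proof
    fix y
    have "partial_sum (m + n) y = partial_sum m y + (\<Sum>k\<in>{m..<m + n}. (transfer_op M T ^^ k) h y)"
      by (simp add: partial_sum_def lessThan_atLeast0 sum.atLeastLessThan_concat)
    also have "(\<Sum>k\<in>{m..<m + n}. (transfer_op M T ^^ k) h y) = shifted m y"
      unfolding shifted_def
      by (rule sum.reindex_bij_witness[of _ "\<lambda>k. m + k" "\<lambda>k. k - m"]) auto
    finally show "partial_sum (m + n) y = partial_sum m y + shifted m y" .
  qed
  ultimately show ?thesis
    using L2_norm_triangle[OF partial_sum_square_integrable sq, of m m] by simp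
qed

lemma norm_partial_sum_le_mean: "L2_norm M (partial_sum N) \<le> 2 * mean_norm N" if "0 < N"
  using subadditive_le_mean[of "\<lambda>n. L2_norm M (partial_sum n)" N] partial_sum_subadditive that
  by (simp add: mean_norm_def field_simps)

lemma mean_norm_nonneg: "0 \<le> mean_norm N"
  by (simp add: mean_norm_def sum_nonneg)

lemma cesaro_square_integrable: "square_integrable M (cesaro N)"
  unfolding cesaro_def[abs_def]
  by (intro square_integrable_scale square_integrable_sum partial_sum_square_integrable)

lemma cesaro_norm: "L2_norm M (cesaro N) \<le> mean_norm N"
  using L2_norm_triangle_sum[of "{1..N}" M partial_sum] partial_sum_square_integrable
  unfolding cesaro_def[abs_def] L2_norm_scale mean_norm_def by (simp add: divide_right_mono)

lemma cesaro_transfer_is_transfer: "is_transfer M T (cesaro N) (cesaro_transfer N)"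
  unfolding cesaro_def[abs_def] cesaro_transfer_def[abs_def]
  by (intro is_transfer_scale is_transfer_sum partial_sum_transfer square_integrable_integrable
      partial_sum_square_integrable)

lemma cesaro_transfer_square_integrable: "square_integrable M (cesaro_transfer N)"
  by (rule is_transfer_square_integrable[OF cesaro_square_integrable cesaro_transfer_is_transfer])

lemma cesaro_transfer_norm: "L2_norm M (cesaro_transfer N) \<le> mean_norm N"
  using is_transfer_contraction[OF cesaro_square_integrable cesaro_transfer_is_transfer] cesaro_norm
  by (rule order_trans)

text \<open>
  This is \<open>P V\<^sub>N / N\<close>, the error in the Poisson equation for \<open>cesaro N\<close>.
\<close>

definition defect :: "nat \<Rightarrow> 'a \<Rightarrow> real" where
  "defect N y = (1 / real N) * (partial_sum (Suc N) y - h y)"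

lemma defect_square_integrable: "square_integrable M (defect N)"
  unfolding defect_def[abs_def]
  by (intro square_integrable_scale square_integrable_diff partial_sum_square_integrable h)

lemma defect_norm:
  assumes "0 < N"
  shows "L2_norm M (defect N) \<le> 2 * mean_norm N / N"
proof -
  have "L2_norm M (\<lambda>y. partial_sum (Suc N) y - h y) \<le> 2 * mean_norm N"
    using is_transfer_contraction[OF partial_sum_square_integrable partial_sum_transfer]
      norm_partial_sum_le_mean[OF assms] by (rule order_trans)
  thus ?thesis
    unfolding defect_def[abs_def] L2_norm_scale by (simp add: divide_right_mono)
qed

text \<open>
  The approximate Poisson equation. The sum over \<open>V\<^sub>k - P V\<^sub>k = V\<^sub>k - V\<^sub>k\<^sub>+\<^sub>1 + h\<close> telescopes.
\<close>

lemma cesaro_minus_transfer: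
  assumes "0 < N"
  shows "cesaro N y - cesaro_transfer N y = h y - defect N y"
proof -
  have "(\<Sum>k=1..N. partial_sum k y) - (\<Sum>k=1..N. partial_sum (Suc k) y - h y)
      = N * h y - (\<Sum>k=1..N. partial_sum (Suc k) y - partial_sum k y)"
    by (simp add: sum_subtractf)
  also have "(\<Sum>k=1..N. partial_sum (Suc k) y - partial_sum k y) = partial_sum (Suc N) y - partial_sum 1 y"
    using assms by (intro sum_Suc_diff) simp
  also have "partial_sum 1 y = h y" by (simp add: partial_sum_def)
  finally show ?thesis
    using assms unfolding cesaro_def cesaro_transfer_def defect_def
    by (simp add: field_simps)
qed

lemma martingale_part_square_integrable: "square_integrable M (martingale_part N)"
  unfolding martingale_part_def[abs_def]
  by (intro square_integrable_diff cesaro_square_integrable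
      measure_preserving_square_integrable[OF mp] cesaro_transfer_square_integrable)

lemma martingale_part_transfer: "is_transfer M T (martingale_part N) (\<lambda>y. 0)"
  unfolding martingale_part_def[abs_def]
  by (rule is_transfer_residual[OF cesaro_square_integrable cesaro_transfer_is_transfer])

text \<open>
  Since \<open>g - U P g = (g - P g) - (U P g - P g)\<close>, replacing \<open>h\<close> by its martingale part costs one
  coboundary, whose Birkhoff sums telescope, and the defect.
\<close>

lemma birkhoff_sum_martingale_part:
  assumes "0 < N"
  shows "(\<Sum>j<n. h ((T ^^ j) y) - martingale_part N ((T ^^ j) y))
    = cesaro_transfer N ((T ^^ n) y) - cesaro_transfer N y + (\<Sum>j<n. defect N ((T ^^ j) y))"
proof -
  have "h z - martingale_part N z = (cesaro_transfer N (T z) - cesaro_transfer N z) + defect N z" for z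
    using cesaro_minus_transfer[OF assms, of z] by (simp add: martingale_part_def)
  hence "(\<Sum>j<n. h ((T ^^ j) y) - martingale_part N ((T ^^ j) y))
      = (\<Sum>j<n. cesaro_transfer N ((T ^^ Suc j) y) - cesaro_transfer N ((T ^^ j) y))
        + (\<Sum>j<n. defect N ((T ^^ j) y))"
    by (simp add: sum.distrib)
  also have "(\<Sum>j<n. cesaro_transfer N ((T ^^ Suc j) y) - cesaro_transfer N ((T ^^ j) y))
      = cesaro_transfer N ((T ^^ n) y) - cesaro_transfer N y"
    using sum_lessThan_telescope[of "\<lambda>j. cesaro_transfer N ((T ^^ j) y)" n] by simp
  finally show ?thesis .
qed

text \<open>
  The boundary terms are bounded uniformly in \<open>n\<close>. The defect is summed without using any
  cancellation, which is harmless as long as \<open>n\<close> is at most a multiple of \<open>N\<close>.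
\<close>

lemma birkhoff_sum_martingale_part_norm:
  assumes "0 < N"
  shows "L2_norm M (\<lambda>y. \<Sum>j<n. h ((T ^^ j) y) - martingale_part N ((T ^^ j) y))
    \<le> 2 * mean_norm N + n * (2 * mean_norm N / N)"
proof -
  note ct = cesaro_transfer_square_integrable
  have "L2_norm M (\<lambda>y. \<Sum>j<n. h ((T ^^ j) y) - martingale_part N ((T ^^ j) y))
      \<le> L2_norm M (\<lambda>y. cesaro_transfer N ((T ^^ n) y) - cesaro_transfer N y)
        + L2_norm M (\<lambda>y. \<Sum>j<n. defect N ((T ^^ j) y))"
    unfolding birkhoff_sum_martingale_part[OF assms]
    by (intro L2_norm_triangle square_integrable_diff square_integrable_funpow ct
        square_integrable_birkhoff_sum defect_square_integrable)
  also have "L2_norm M (\<lambda>y. cesaro_transfer N ((T ^^ n) y) - cesaro_transfer N y)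
      \<le> L2_norm M (cesaro_transfer N) + L2_norm M (cesaro_transfer N)"
    using L2_norm_triangle_diff[OF square_integrable_funpow[OF ct] ct, of N n N]
    by (simp add: L2_norm_funpow[OF ct])
  also have "\<dots> \<le> 2 * mean_norm N" using cesaro_transfer_norm[of N] by simp
  also have "L2_norm M (\<lambda>y. \<Sum>j<n. defect N ((T ^^ j) y)) \<le> n * L2_norm M (defect N)"
    by (rule L2_norm_birkhoff_sum_le[OF defect_square_integrable])
  also have "\<dots> \<le> n * (2 * mean_norm N / N)"
    by (intro mult_left_mono defect_norm assms) simp
  finally show ?thesis by simp
qed

text \<open>
  In the factorisation \<open>\<parallel>D\<parallel>\<^sup>2 - \<parallel>P D\<parallel>\<^sup>2 = (\<parallel>D\<parallel> + \<parallel>P D\<parallel>) (\<parallel>D\<parallel> - \<parallel>P D\<parallel>)\<close> the second factor is at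
  most \<open>\<parallel>D - P D\<parallel>\<close>, where \<open>h\<close> cancels from the two Poisson equations and only the defects remain.
  The triangle inequality alone would lose this gain of a factor \<open>N\<close>.
\<close>

lemma martingale_part_diff_norm:
  assumes "0 < N" "0 < N'"
  shows "(L2_norm M (\<lambda>y. martingale_part N' y - martingale_part N y))\<^sup>2
    \<le> 2 * (mean_norm N + mean_norm N') * (2 * mean_norm N / N + 2 * mean_norm N' / N')"
proof -
  define D where "D y = cesaro N' y - cesaro N y" for y
  define D' where "D' y = cesaro_transfer N' y - cesaro_transfer N y" for y
  have D: "square_integrable M D"
    unfolding D_def[abs_def] by (intro square_integrable_diff cesaro_square_integrable)
  have tr: "is_transfer M T D D'"
    unfolding D_def[abs_def] D'_def[abs_def]
    by (intro is_transfer_diff cesaro_transfer_is_transfer square_integrable_integrable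
        cesaro_square_integrable)
  note D' = is_transfer_square_integrable[OF D tr]
  have D_norm: "L2_norm M D \<le> mean_norm N + mean_norm N'"
    unfolding D_def[abs_def]
    using L2_norm_triangle_diff[OF cesaro_square_integrable cesaro_square_integrable, of N' N]
      cesaro_norm[of N] cesaro_norm[of N'] by simp
  have "D y - D' y = defect N y - defect N' y" for y
    using cesaro_minus_transfer[OF assms(1), of y] cesaro_minus_transfer[OF assms(2), of y]
    unfolding D_def D'_def by linarith
  hence residual: "L2_norm M (\<lambda>y. D y - D' y) \<le> 2 * mean_norm N / N + 2 * mean_norm N' / N'"
    using L2_norm_triangle_diff[OF defect_square_integrable defect_square_integrable, of N N']
      defect_norm[OF assms(1)] defect_norm[OF assms(2)] by simp
  have "(L2_norm M (\<lambda>y. martingale_part N' y - martingale_part N y))\<^sup>2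
      = (L2_norm M (\<lambda>y. D y - D' (T y)))\<^sup>2"
    by (simp add: martingale_part_def D_def D'_def algebra_simps)
  also have "\<dots> = (L2_norm M D)\<^sup>2 - (L2_norm M D')\<^sup>2"
    by (rule is_transfer_residual_norm[OF D tr])
  also have "\<dots> = (L2_norm M D + L2_norm M D') * (L2_norm M D - L2_norm M D')"
    by (simp add: power2_eq_square algebra_simps)
  also have "\<dots> \<le> (2 * (mean_norm N + mean_norm N')) * (2 * mean_norm N / N + 2 * mean_norm N' / N')"
  proof (rule mult_mono)
    show "L2_norm M D + L2_norm M D' \<le> 2 * (mean_norm N + mean_norm N')"
      using D_norm is_transfer_contraction[OF D tr] by simp
    show "L2_norm M D - L2_norm M D' \<le> 2 * mean_norm N / N + 2 * mean_norm N' / N'"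
      using L2_norm_reverse_triangle[OF D D'] residual by simp
    show "0 \<le> 2 * (mean_norm N + mean_norm N')" by (simp add: mean_norm_nonneg)
    show "0 \<le> L2_norm M D - L2_norm M D'"
      using is_transfer_contraction[OF D tr] by simp
  qed
  finally show ?thesis .
qed

lemma martingale_approximation:
  assumes summ: "summable (\<lambda>m. real (Suc m) powr (- 3 / 2) * L2_norm M (partial_sum (Suc m)))"
  shows "\<exists>h'. square_integrable M h' \<and> is_transfer M T h' (\<lambda>y. 0) \<and>
    (\<lambda>n. L2_norm M (\<lambda>y. (1 / sqrt (real n)) * (\<Sum>j<n. h ((T ^^ j) y) - h' ((T ^^ j) y)))) \<longlonglongrightarrow> 0"
proof -
  define B where "B j = mean_norm (4 ^ j) / 2 ^ j" for j
  define m where "m j = martingale_part (4 ^ j)" for j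
  have m: "square_integrable M (m j)" "is_transfer M T (m j) (\<lambda>y. 0)" for j
    by (simp_all add: m_def martingale_part_square_integrable martingale_part_transfer)
  have B0: "0 \<le> B j" for j by (simp add: B_def mean_norm_nonneg)
  have mean_B: "mean_norm (4 ^ j) = 2 ^ j * B j" for j by (simp add: B_def)
  have "B j = (\<Sum>k=1..4 ^ j. L2_norm M (partial_sum k)) / 8 ^ j" for j
    by (simp add: B_def mean_norm_def flip: power_mult_distrib)
  hence "B = (\<lambda>j. (\<Sum>k=1..4 ^ j. L2_norm M (partial_sum k)) / 8 ^ j)" by blast
  hence summ_B: "summable B"
    using summable_means_powers_of_four[of "\<lambda>n. L2_norm M (partial_sum n)", OF _ summ]
    by (simp only: L2_norm_nonneg)
  have step: "L2_norm M (\<lambda>y. m (Suc j) y - m j y) \<le> 2 * (B j + 2 * B (Suc j))" for j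
  proof (rule power2_le_imp_le)
    have "(L2_norm M (\<lambda>y. m (Suc j) y - m j y))\<^sup>2
        \<le> 2 * (2 ^ j * B j + 2 ^ Suc j * B (Suc j))
          * (2 * (2 ^ j * B j) / 4 ^ j + 2 * (2 ^ Suc j * B (Suc j)) / 4 ^ Suc j)"
      using martingale_part_diff_norm[of "4 ^ j" "4 ^ Suc j"]
      unfolding m_def mean_B[symmetric] by (simp del: power_Suc)
    also have "\<dots> = 4 * (B j + 2 * B (Suc j)) * (B j + B (Suc j) / 2)"
    proof -
      have "(4::real) ^ j = 2 ^ j * 2 ^ j" by (simp flip: power_mult_distrib)
      thus ?thesis by (simp add: field_simps)
    qed
    also have "\<dots> \<le> 4 * (B j + 2 * B (Suc j)) * (B j + 2 * B (Suc j))"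
      using B0[of j] B0[of "Suc j"] by (intro mult_left_mono) auto
    finally show "(L2_norm M (\<lambda>y. m (Suc j) y - m j y))\<^sup>2 \<le> (2 * (B j + 2 * B (Suc j)))\<^sup>2"
      by (simp add: power2_eq_square algebra_simps)
  qed (simp add: B0)
  have "summable (\<lambda>j. L2_norm M (\<lambda>y. m (Suc j) y - m j y))"
  proof (rule summable_comparison_test')
    show "summable (\<lambda>j. 2 * (B j + 2 * B (Suc j)))"
      using summ_B by (intro summable_mult summable_add) (simp_all add: summable_Suc_iff)
  qed (use step in auto)
  then obtain h' where h': "square_integrable M h'"
    and lim: "(\<lambda>j. L2_norm M (\<lambda>y. m j y - h' y)) \<longlonglongrightarrow> 0"
    using L2_complete_summable[of m] m(1) by blast
  have md: "square_integrable M (\<lambda>y. m j y - h' y)" for j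
    by (intro square_integrable_diff m h')
  \<comment> \<open>\<open>P h'\<close> vanishes because \<open>P (m j) = 0\<close> and \<open>P\<close> is a contraction.\<close>
  define g where "g = transfer_op M T h'"
  note g = transfer_op_square_integrable[OF h', folded g_def]
  have trd: "is_transfer M T (\<lambda>y. m j y - h' y) (\<lambda>y. 0 - g y)" for j
    by (intro is_transfer_diff m g square_integrable_integrable h')
  have "L2_norm M g \<le> L2_norm M (\<lambda>y. m j y - h' y)" for j
    using is_transfer_contraction[OF md trd, of j] by (simp add: L2_norm_def)
  hence "L2_norm M g \<le> 0"
    by (intro LIMSEQ_le_const[OF lim]) auto
  hence "(\<integral>y. (g y)\<^sup>2 \<partial>M) = 0" by (simp add: L2_norm_def real_sqrt_le_0_iff antisym)
  hence g0: "AE y in M. g y = 0"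
    using g(2) by (subst (asm) integral_nonneg_eq_0_iff_AE) (auto simp: square_integrable_def)
  have tr: "is_transfer M T h' (\<lambda>y. 0)"
    by (rule is_transfer_cong_AE[OF g(1)]) (use g0 in auto)
  have trd: "is_transfer M T (\<lambda>y. m j y - h' y) (\<lambda>y. 0)" for j
    using is_transfer_diff[OF m(2)[of j] tr] m(1) h' by (simp add: square_integrable_integrable)
  have conv: "(\<lambda>n. L2_norm M (\<lambda>y. (1 / sqrt (real n)) * (\<Sum>j<n. h ((T ^^ j) y) - h' ((T ^^ j) y)))) \<longlonglongrightarrow> 0"
  proof (rule LIMSEQ_I)
    fix e :: real assume e: "0 < e"
    define \<epsilon> where "\<epsilon> = e / 12"
    have "0 < \<epsilon>" using e by (simp add: \<epsilon>_def)
    then obtain J1 J2 where J1: "\<And>j. j \<ge> J1 \<Longrightarrow> L2_norm M (\<lambda>y. m j y - h' y) < \<epsilon>"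
      and J2: "\<And>j. j \<ge> J2 \<Longrightarrow> B j < \<epsilon>"
      using order_tendstoD(2)[OF lim] order_tendstoD(2)[OF summable_LIMSEQ_zero[OF summ_B]]
      unfolding eventually_sequentially by meson
    show "\<exists>no. \<forall>n\<ge>no. norm (L2_norm M (\<lambda>y. (1 / sqrt (real n)) * (\<Sum>j<n. h ((T ^^ j) y) - h' ((T ^^ j) y))) - 0) < e"
    proof (intro exI allI impI)
      fix n :: nat assume n: "4 ^ (max J1 J2) \<le> n"
      hence n1: "1 \<le> n" using one_le_power[of "4::nat" "max J1 J2"] by linarith
      \<comment> \<open>The block length \<open>4 ^ j\<close> must be comparable to \<open>n\<close>, so it depends on \<open>n\<close>.\<close>
      then obtain j where j: "4 ^ j \<le> n" "n < 4 ^ (j + 1)"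
        using ex_power_ivl1[of 4 n] by auto
      have "(4::nat) ^ max J1 J2 < 4 ^ (j + 1)" using n j(2) by linarith
      hence jJ: "J1 \<le> j" "J2 \<le> j" by (auto simp: power_strict_increasing_iff less_Suc_eq_le simp del: power_Suc)
      have 2: "2 ^ j \<le> sqrt n"
      proof (rule real_le_rsqrt)
        have "(2 ^ j)\<^sup>2 = real (4 ^ j)" by (simp add: power2_eq_square flip: power_mult_distrib)
        also have "\<dots> \<le> real n" using j(1) by (simp only: of_nat_le_iff)
        finally show "(2 ^ j)\<^sup>2 \<le> real n" .
      qed
      have ratio: "real n / 4 ^ j \<le> 4"
      proof -
        have "real n \<le> real (4 ^ (j + 1))" using j(2) by (simp only: of_nat_le_iff less_imp_le)
        thus ?thesis by (simp add: field_simps)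
      qed
      have mn0: "0 \<le> mean_norm (4 ^ j)" by (rule mean_norm_nonneg)
      have "L2_norm M (\<lambda>y. \<Sum>i<n. h ((T ^^ i) y) - h' ((T ^^ i) y))
          = L2_norm M (\<lambda>y. (\<Sum>i<n. h ((T ^^ i) y) - m j ((T ^^ i) y)) + (\<Sum>i<n. m j ((T ^^ i) y) - h' ((T ^^ i) y)))"
        by (simp add: sum_subtractf)
      also have "\<dots> \<le> L2_norm M (\<lambda>y. \<Sum>i<n. h ((T ^^ i) y) - m j ((T ^^ i) y))
          + L2_norm M (\<lambda>y. \<Sum>i<n. m j ((T ^^ i) y) - h' ((T ^^ i) y))"
        using h m h' by (intro L2_norm_triangle square_integrable_sum square_integrable_diff square_integrable_funpow)
      also have "L2_norm M (\<lambda>y. \<Sum>i<n. m j ((T ^^ i) y) - h' ((T ^^ i) y)) = sqrt n * L2_norm M (\<lambda>y. m j y - h' y)"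
        by (rule L2_norm_birkhoff_sum_kernel[OF md trd])
      also have "\<dots> \<le> sqrt n * \<epsilon>"
        using J1[OF jJ(1)] by (intro mult_left_mono) auto
      also have "L2_norm M (\<lambda>y. \<Sum>i<n. h ((T ^^ i) y) - m j ((T ^^ i) y))
          \<le> 2 * mean_norm (4 ^ j) + (real n / 4 ^ j) * (2 * mean_norm (4 ^ j))"
        using birkhoff_sum_martingale_part_norm[of "4 ^ j" n] by (simp add: m_def)
      also have "\<dots> \<le> 2 * mean_norm (4 ^ j) + 4 * (2 * mean_norm (4 ^ j))"
        using ratio mn0 by (intro add_left_mono mult_right_mono) auto
      also have "\<dots> = 10 * (2 ^ j * B j)" by (simp add: mean_B)
      also have "\<dots> \<le> 10 * (sqrt n * \<epsilon>)"
        using 2 J2[OF jJ(2)] B0[of j] by (intro mult_left_mono mult_mono) auto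
      finally have "L2_norm M (\<lambda>y. \<Sum>i<n. h ((T ^^ i) y) - h' ((T ^^ i) y)) \<le> sqrt n * (11 * \<epsilon>)"
        by (simp add: algebra_simps)
      hence "L2_norm M (\<lambda>y. (1 / sqrt (real n)) * (\<Sum>i<n. h ((T ^^ i) y) - h' ((T ^^ i) y))) \<le> 11 * \<epsilon>"
        using n1 unfolding L2_norm_scale by (simp add: field_simps)
      also have "\<dots> < e" using e by (simp add: \<epsilon>_def)
      finally show "norm (L2_norm M (\<lambda>y. (1 / sqrt (real n)) * (\<Sum>j<n. h ((T ^^ j) y) - h' ((T ^^ j) y))) - 0) < e"
        by simp
    qed
  qed
  from h' tr conv show ?thesis by blast
qed

end

section \<open>The mean ergodic theorem\<close>

context measure_preserving_system
begin

lemma funpow_T_shift: "(T ^^ n) (T y) = (T ^^ Suc n) y"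
  by (simp add: funpow_swap1)

text \<open>
  Ergodicity is stated for sets that equal their preimage exactly, whereas \<open>{f > 0}\<close> is invariant
  only up to a null set. The set of points whose orbit eventually stays in \<open>{f > 0}\<close> is exactly
  invariant and agrees with \<open>{f > 0}\<close> almost everywhere. So \<open>f\<close> has a constant sign, and the
  vanishing integral does the rest.
\<close>

lemma ergodic_invariant_eq_zero:
  fixes f :: "'a \<Rightarrow> real"
  assumes erg: "ergodic M T" and f: "integrable M f" and inv: "AE y in M. f (T y) = f y"
    and mean: "(\<integral>y. f y \<partial>M) = 0"
  shows "AE y in M. f y = 0"
proof -
  have [measurable]: "f \<in> borel_measurable M" using f by simp
  define A where "A = {y \<in> space M. \<exists>N. \<forall>n\<ge>N. 0 < f ((T ^^ n) y)}"
  have A [measurable]: "A \<in> sets M" unfolding A_def by measurable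
  have tail: "(\<exists>N. \<forall>n\<ge>N. 0 < f ((T ^^ Suc n) y)) \<longleftrightarrow> (\<exists>N. \<forall>n\<ge>N. 0 < f ((T ^^ n) y))" for y
  proof
    assume "\<exists>N. \<forall>n\<ge>N. 0 < f ((T ^^ Suc n) y)"
    then obtain N where N: "\<And>n. n \<ge> N \<Longrightarrow> 0 < f ((T ^^ Suc n) y)" by blast
    have "0 < f ((T ^^ n) y)" if "n \<ge> Suc N" for n
      using N[of "n - 1"] that by (cases n) auto
    thus "\<exists>N. \<forall>n\<ge>N. 0 < f ((T ^^ n) y)" by blast
  next
    assume "\<exists>N. \<forall>n\<ge>N. 0 < f ((T ^^ n) y)"
    thus "\<exists>N. \<forall>n\<ge>N. 0 < f ((T ^^ Suc n) y)" by (meson le_SucI)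
  qed
  have "T -` A \<inter> space M = A"
    unfolding A_def using tail funpow_T_shift T_space by (auto simp del: funpow.simps)
  hence A01: "measure M A = 0 \<or> measure M A = 1"
    using erg A by (auto simp: ergodic_def)
  have "AE y in M. f ((T ^^ n) y) = f y" for n
  proof (induction n)
    case (Suc n)
    have "AE y in M. f ((T ^^ n) (T y)) = f (T y)"
      by (rule measure_preserving_AE[OF mp Suc])
    with inv show ?case unfolding funpow_T_shift by eventually_elim simp
  qed simp
  hence "AE y in M. \<forall>n. f ((T ^^ n) y) = f y" by (simp add: AE_all_countable)
  hence A_iff: "AE y in M. y \<in> A \<longleftrightarrow> 0 < f y"
    using AE_space by eventually_elim (auto simp: A_def)
  from A01 show ?thesis
  proof
    assume "measure M A = 0"
    hence "AE y in M. y \<notin> A" by (simp add: prob_eq_0)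
    hence "AE y in M. 0 \<le> - f y" using A_iff by eventually_elim auto
    hence "AE y in M. - f y = 0"
      using f mean by (subst integral_nonneg_eq_0_iff_AE[symmetric]) auto
    thus ?thesis by simp
  next
    assume "measure M A = 1"
    hence "AE y in M. y \<in> A" by (simp add: prob_eq_1)
    hence "AE y in M. 0 \<le> f y" using A_iff by eventually_elim auto
    thus ?thesis
      using f mean by (subst integral_nonneg_eq_0_iff_AE[symmetric]) auto
  qed
qed

text \<open>
  Shifting by one step changes a Birkhoff sum only by its two end terms, whatever its length.
\<close>

lemma birkhoff_sum_shift_norm:
  assumes f: "square_integrable M f"
  shows "L2_norm M (\<lambda>y. (\<Sum>j<N. f ((T ^^ j) y)) - (\<Sum>j<N. f ((T ^^ (j + i)) y))) \<le> 2 * real i * L2_norm M f"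
proof -
  have "(\<Sum>j<N. f ((T ^^ j) y)) - (\<Sum>j<N. f ((T ^^ (j + i)) y))
      = (\<Sum>l<i. f ((T ^^ l) y) - f ((T ^^ (N + l)) y))" for y
  proof (induction i)
    case (Suc i)
    have "(\<Sum>j<N. f ((T ^^ (j + i)) y)) - (\<Sum>j<N. f ((T ^^ (Suc j + i)) y))
        = f ((T ^^ i) y) - f ((T ^^ (N + i)) y)"
      using sum_lessThan_telescope'[of "\<lambda>j. f ((T ^^ (j + i)) y)" N] by (simp add: sum_subtractf)
    with Suc show ?case by simp
  qed simp
  moreover have "L2_norm M (\<lambda>y. \<Sum>l<i. f ((T ^^ l) y) - f ((T ^^ (N + l)) y))
      \<le> (\<Sum>l<i. L2_norm M (\<lambda>y. f ((T ^^ l) y) - f ((T ^^ (N + l)) y)))"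
    by (intro L2_norm_triangle_sum square_integrable_diff square_integrable_funpow f)
  moreover have "L2_norm M (\<lambda>y. f ((T ^^ l) y) - f ((T ^^ (N + l)) y)) \<le> 2 * L2_norm M f" for l
    using L2_norm_triangle_diff[OF square_integrable_funpow[OF f] square_integrable_funpow[OF f], of l "N + l"]
    by (simp only: L2_norm_funpow[OF f])
  hence "(\<Sum>l<i. L2_norm M (\<lambda>y. f ((T ^^ l) y) - f ((T ^^ (N + l)) y))) \<le> (\<Sum>l<i. 2 * L2_norm M f)"
    by (intro sum_mono)
  ultimately show ?thesis by simp
qed

lemma birkhoff_sum_average_norm:
  assumes f: "square_integrable M f" and n: "0 < n"
  shows "L2_norm M (\<lambda>y. (\<Sum>j<N. f ((T ^^ j) y))
      - (\<Sum>j<N. (1 / real n) * (\<Sum>i<n. f ((T ^^ i) ((T ^^ j) y))))) \<le> 2 * real n * L2_norm M f"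
proof -
  have eq: "(\<Sum>j<N. f ((T ^^ j) y)) - (\<Sum>j<N. (1 / real n) * (\<Sum>i<n. f ((T ^^ i) ((T ^^ j) y))))
      = (1 / real n) * (\<Sum>i<n. (\<Sum>j<N. f ((T ^^ j) y)) - (\<Sum>j<N. f ((T ^^ (j + i)) y)))" for y
  proof -
    have "(\<Sum>j<N. \<Sum>i<n. f ((T ^^ i) ((T ^^ j) y))) = (\<Sum>i<n. \<Sum>j<N. f ((T ^^ (j + i)) y))"
      by (subst sum.swap) (simp add: funpow_add add.commute)
    thus ?thesis using n
      by (simp add: sum_subtractf sum_divide_distrib[symmetric] diff_divide_distrib)
  qed
  have "L2_norm M (\<lambda>y. \<Sum>i<n. (\<Sum>j<N. f ((T ^^ j) y)) - (\<Sum>j<N. f ((T ^^ (j + i)) y)))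
      \<le> (\<Sum>i<n. L2_norm M (\<lambda>y. (\<Sum>j<N. f ((T ^^ j) y)) - (\<Sum>j<N. f ((T ^^ (j + i)) y))))"
    by (intro L2_norm_triangle_sum square_integrable_diff square_integrable_sum square_integrable_funpow f)
  also have "\<dots> \<le> (\<Sum>i<n. 2 * real n * L2_norm M f)"
  proof (rule sum_mono)
    fix i assume "i \<in> {..<n}"
    hence "2 * real i * L2_norm M f \<le> 2 * real n * L2_norm M f"
      by (intro mult_right_mono) auto
    with birkhoff_sum_shift_norm[OF f]
    show "L2_norm M (\<lambda>y. (\<Sum>j<N. f ((T ^^ j) y)) - (\<Sum>j<N. f ((T ^^ (j + i)) y))) \<le> 2 * real n * L2_norm M f"
      by (rule order_trans)
  qed
  finally show ?thesis
    unfolding eq L2_norm_scale using n by (simp add: field_simps)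
qed

text \<open>
  Riesz's proof of von Neumann's theorem. Let \<open>\<mu>\<close> be the infimum of the norms of the averages
  \<open>g\<^sub>n\<close>. Averaging is insensitive to replacing \<open>f\<close> by an average of its translates, so \<open>\<parallel>g\<^sub>N\<parallel>\<close> is
  asymptotically at most the norm of any average of translates of \<open>f\<close>. For \<open>g\<^sub>n\<close> itself this gives \<open>\<parallel>g\<^sub>N\<parallel> \<rightarrow> \<mu>\<close>;
  for the midpoint of \<open>g\<^sub>n\<close> and \<open>g\<^sub>m\<close> it shows that the midpoint has norm at least \<open>\<mu>\<close>, whence the
  averages are Cauchy by the parallelogram law. A limit is invariant with mean zero, hence vanishes.
\<close>

lemma mean_ergodic_theorem:
  assumes erg: "ergodic M T" and f: "square_integrable M f" and mean: "(\<integral>y. f y \<partial>M) = 0"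
  shows "(\<lambda>n. L2_norm M (\<lambda>y. (1 / real n) * (\<Sum>j<n. f ((T ^^ j) y)))) \<longlonglongrightarrow> 0"
proof -
  define C where "C = L2_norm M f"
  define g where "g n y = (1 / real n) * (\<Sum>j<n. f ((T ^^ j) y))" for n y
  define b where "b n = L2_norm M (g n)" for n
  define \<mu> where "\<mu> = Inf (b ` {0<..})"
  have C0: "0 \<le> C" and b0: "0 \<le> b n" for n by (simp_all add: C_def b_def)
  have g: "square_integrable M (g n)" for n
    unfolding g_def[abs_def] by (intro square_integrable_scale square_integrable_birkhoff_sum f)
  have mid: "square_integrable M (\<lambda>y. (1/2) * (g n y + g m y))" for n m
    by (intro square_integrable_scale square_integrable_add g)
  have bdd: "bdd_below (b ` {0<..})" by (rule bdd_belowI[of _ 0]) (use b0 in auto)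
  have \<mu>_le: "\<mu> \<le> b n" if "0 < n" for n
    unfolding \<mu>_def using that by (intro cInf_lower bdd) auto
  have \<mu>0: "0 \<le> \<mu>" unfolding \<mu>_def by (intro cInf_greatest) (use b0 in auto)
  \<comment> \<open>For \<open>m = n\<close> the midpoint is \<open>g n\<close> itself.\<close>
  have key: "b N \<le> L2_norm M (\<lambda>y. (1/2) * (g n y + g m y)) + real (n + m) * C / N"
    if "0 < n" "0 < m" "0 < N" for n m N
  proof -
    define S where "S u y = (\<Sum>j<N. u ((T ^^ j) y))" for u :: "'a \<Rightarrow> real" and y
    have S: "square_integrable M (S u)" if "square_integrable M u" for u
      unfolding S_def[abs_def] by (intro square_integrable_birkhoff_sum that)
    define k where "k y = (1/2) * (g n y + g m y)" for y
    have k: "square_integrable M k" unfolding k_def[abs_def] by (rule mid)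
    have close: "L2_norm M (\<lambda>y. S f y - S (g i) y) \<le> 2 * real i * C" if "0 < i" for i
      using birkhoff_sum_average_norm[OF f that, of N] by (simp add: S_def g_def C_def)
    have "S f y - S k y = (1/2) * ((S f y - S (g n) y) + (S f y - S (g m) y))" for y
      by (simp add: S_def k_def sum.distrib add_divide_distrib sum_divide_distrib[symmetric])
    hence "L2_norm M (\<lambda>y. S f y - S k y)
        = (1/2) * L2_norm M (\<lambda>y. (S f y - S (g n) y) + (S f y - S (g m) y))"
      by (simp only: L2_norm_scale)
    also have "\<dots> \<le> (1/2) * (L2_norm M (\<lambda>y. S f y - S (g n) y) + L2_norm M (\<lambda>y. S f y - S (g m) y))"
      by (intro mult_left_mono L2_norm_triangle square_integrable_diff S f g) auto
    also have "\<dots> \<le> real (n + m) * C"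
      using close[OF \<open>0 < n\<close>] close[OF \<open>0 < m\<close>] by (simp add: algebra_simps)
    finally have "L2_norm M (\<lambda>y. S f y - S k y) \<le> real (n + m) * C" .
    moreover have "L2_norm M (S f) \<le> L2_norm M (\<lambda>y. S f y - S k y) + L2_norm M (S k)"
      using L2_norm_triangle[OF square_integrable_diff[OF S[OF f] S[OF k]] S[OF k]] by simp
    moreover have "L2_norm M (S k) \<le> N * L2_norm M k"
      unfolding S_def[abs_def] by (rule L2_norm_birkhoff_sum_le[OF k])
    moreover have "real N * b N = L2_norm M (S f)"
      using \<open>0 < N\<close> unfolding b_def g_def[abs_def] L2_norm_scale by (simp add: S_def[abs_def])
    ultimately have "real N * b N \<le> real (n + m) * C + N * L2_norm M k" by linarith
    thus ?thesis using \<open>0 < N\<close> by (simp add: k_def[abs_def] field_simps)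
  qed
  have vanish: "(\<lambda>N. x / real N) \<longlonglongrightarrow> 0" for x :: real
    by (rule lim_const_over_n)
  have \<mu>_mid: "\<mu> \<le> L2_norm M (\<lambda>y. (1/2) * (g n y + g m y))" if "0 < n" "0 < m" for n m
  proof (rule LIMSEQ_le_const)
    show "(\<lambda>N. L2_norm M (\<lambda>y. (1/2) * (g n y + g m y)) + real (n + m) * C / N)
        \<longlonglongrightarrow> L2_norm M (\<lambda>y. (1/2) * (g n y + g m y))"
      using tendsto_add[OF tendsto_const vanish] by simp
    show "\<exists>K. \<forall>N\<ge>K. \<mu> \<le> L2_norm M (\<lambda>y. (1/2) * (g n y + g m y)) + real (n + m) * C / real N"
    proof (intro exI allI impI)
      fix N :: nat assume "1 \<le> N"
      hence "0 < N" by simp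
      from order_trans[OF \<mu>_le[OF this] key[OF that this]]
      show "\<mu> \<le> L2_norm M (\<lambda>y. (1/2) * (g n y + g m y)) + real (n + m) * C / N" .
    qed
  qed
  have b_lim: "b \<longlonglongrightarrow> \<mu>"
  proof (rule LIMSEQ_I)
    fix e :: real assume e: "0 < e"
    hence "Inf (b ` {0<..}) < \<mu> + e / 2" by (simp add: \<mu>_def)
    then obtain n where n: "0 < n" "b n < \<mu> + e / 2"
      by (subst (asm) cInf_less_iff) (use bdd in auto)
    have "eventually (\<lambda>N. real (n + n) * C / N < e / 2) sequentially"
      using e by (intro order_tendstoD(2)[OF vanish]) simp
    then obtain K where K: "\<And>N. N \<ge> K \<Longrightarrow> real (n + n) * C / real N < e / 2"
      unfolding eventually_sequentially by blast
    show "\<exists>no. \<forall>N\<ge>no. norm (b N - \<mu>) < e"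
    proof (intro exI allI impI)
      fix N assume N: "max K 1 \<le> N"
      have "b N \<le> b n + real (n + n) * C / N"
        using key[of n n N] n N by (simp add: b_def)
      moreover have "real (n + n) * C / N < e / 2" using K N by simp
      moreover have "\<mu> \<le> b N" using \<mu>_le N by simp
      ultimately show "norm (b N - \<mu>) < e" using n(2) by simp
    qed
  qed
  have parallelogram: "(L2_norm M (\<lambda>y. g n y - g m y))\<^sup>2 \<le> 2 * ((b n)\<^sup>2 - \<mu>\<^sup>2) + 2 * ((b m)\<^sup>2 - \<mu>\<^sup>2)"
    if "0 < n" "0 < m" for n m
  proof -
    have "\<mu>\<^sup>2 \<le> (L2_norm M (\<lambda>y. (1/2) * (g n y + g m y)))\<^sup>2"
      by (intro power_mono \<mu>_mid that \<mu>0)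
    also have "\<dots> = (L2_norm M (\<lambda>y. g n y + g m y))\<^sup>2 / 4"
      unfolding L2_norm_scale by (simp add: power2_eq_square)
    finally have "4 * \<mu>\<^sup>2 \<le> (L2_norm M (\<lambda>y. g n y + g m y))\<^sup>2" by simp
    thus ?thesis
      using L2_norm_add_power2[OF g g, of n m] L2_norm_diff_power2[OF g g, of n m]
      by (simp add: b_def)
  qed
  have "\<exists>r. \<forall>k. k < r k \<and> (b (r k))\<^sup>2 - \<mu>\<^sup>2 < (1/4) ^ k"
  proof (rule choice, rule allI)
    fix k :: nat
    have "(\<lambda>n. (b n)\<^sup>2 - \<mu>\<^sup>2) \<longlonglongrightarrow> \<mu>\<^sup>2 - \<mu>\<^sup>2" by (intro tendsto_intros b_lim)
    hence "eventually (\<lambda>n. (b n)\<^sup>2 - \<mu>\<^sup>2 < (1/4) ^ k) sequentially"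
      by (intro order_tendstoD(2)) auto
    with eventually_gt_at_top[of k] have "eventually (\<lambda>n. k < n \<and> (b n)\<^sup>2 - \<mu>\<^sup>2 < (1/4) ^ k) sequentially"
      by eventually_elim simp
    thus "\<exists>n. k < n \<and> (b n)\<^sup>2 - \<mu>\<^sup>2 < (1/4) ^ k"
      unfolding eventually_sequentially by blast
  qed
  \<comment> \<open>A subsequence with summable steps is enough, because the norms converge along the full sequence.\<close>
  then obtain r where r: "\<And>k. k < r k" "\<And>k. (b (r k))\<^sup>2 - \<mu>\<^sup>2 < (1/4) ^ k" by blast
  have r_lim: "filterlim r sequentially sequentially"
    using less_imp_le[OF r(1)] by (intro filterlim_at_top_mono[OF filterlim_ident] always_eventually) blast
  have steps: "L2_norm M (\<lambda>y. g (r (Suc k)) y - g (r k) y) \<le> 2 * (1/2) ^ k" for k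
  proof (rule power2_le_imp_le)
    have "(L2_norm M (\<lambda>y. g (r (Suc k)) y - g (r k) y))\<^sup>2
        \<le> 2 * ((b (r (Suc k)))\<^sup>2 - \<mu>\<^sup>2) + 2 * ((b (r k))\<^sup>2 - \<mu>\<^sup>2)"
      using r(1)[of k] r(1)[of "Suc k"] by (intro parallelogram) auto
    also have "\<dots> \<le> 2 * (1/4) ^ Suc k + 2 * (1/4) ^ k"
      using r(2)[of k] r(2)[of "Suc k"] by simp
    also have "\<dots> \<le> 4 * (1/4) ^ k" by simp
    also have "(1/4 :: real) ^ k = ((1/2) ^ k)\<^sup>2"
      by (simp add: power2_eq_square flip: power_mult_distrib)
    finally show "(L2_norm M (\<lambda>y. g (r (Suc k)) y - g (r k) y))\<^sup>2 \<le> (2 * (1/2) ^ k)\<^sup>2"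
      by (simp add: power_mult_distrib)
  qed simp
  have geometric: "summable (\<lambda>k. 2 * (1/2 :: real) ^ k)"
    by (intro summable_mult summable_geometric) simp
  have "summable (\<lambda>k. L2_norm M (\<lambda>y. g (r (Suc k)) y - g (r k) y))"
    by (rule summable_comparison_test'[OF geometric, of 0]) (use steps in simp)
  then obtain F where F: "square_integrable M F"
    and F_lim: "(\<lambda>k. L2_norm M (\<lambda>y. g (r k) y - F y)) \<longlonglongrightarrow> 0"
    using L2_complete_summable[of "\<lambda>k. g (r k)"] g by blast
  note FT = measure_preserving_square_integrable[OF mp F]
  note gT = measure_preserving_square_integrable[OF mp g]
  have "L2_norm M (\<lambda>y. F (T y) - F y) \<le> 0"
  proof (rule LIMSEQ_le_const)
    show "(\<lambda>k. L2_norm M (\<lambda>y. g (r k) y - F y) + (2 * C / real (r k) + L2_norm M (\<lambda>y. g (r k) y - F y))) \<longlonglongrightarrow> 0"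
      using tendsto_add[OF F_lim tendsto_add[OF filterlim_compose[OF vanish r_lim] F_lim]] by simp
    show "\<exists>K. \<forall>k\<ge>K. L2_norm M (\<lambda>y. F (T y) - F y)
        \<le> L2_norm M (\<lambda>y. g (r k) y - F y) + (2 * C / real (r k) + L2_norm M (\<lambda>y. g (r k) y - F y))"
    proof (intro exI allI impI)
      fix k
      have "L2_norm M (\<lambda>y. F (T y) - F y)
          \<le> L2_norm M (\<lambda>y. F (T y) - g (r k) (T y)) + L2_norm M (\<lambda>y. g (r k) (T y) - F y)"
        by (intro L2_norm_diff_triangle FT gT F)
      also have "L2_norm M (\<lambda>y. F (T y) - g (r k) (T y)) = L2_norm M (\<lambda>y. g (r k) y - F y)"
        using measure_preserving_L2_norm[OF mp square_integrable_diff[OF F g]]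
        by (simp add: L2_norm_minus_commute)
      also have "L2_norm M (\<lambda>y. g (r k) (T y) - F y)
          \<le> L2_norm M (\<lambda>y. g (r k) (T y) - g (r k) y) + L2_norm M (\<lambda>y. g (r k) y - F y)"
        by (intro L2_norm_diff_triangle FT gT F g)
      also have "L2_norm M (\<lambda>y. g (r k) (T y) - g (r k) y) \<le> 2 * C / real (r k)"
      proof -
        have "g (r k) y - g (r k) (T y) = (1 / real (r k)) *
            ((\<Sum>j<r k. f ((T ^^ j) y)) - (\<Sum>j<r k. f ((T ^^ (j + 1)) y)))" for y
          by (simp add: g_def right_diff_distrib funpow_swap1)
        hence "L2_norm M (\<lambda>y. g (r k) y - g (r k) (T y)) \<le> 2 * C / real (r k)"
          using birkhoff_sum_shift_norm[OF f, of "r k" 1]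
            L2_norm_scale[of M "1 / real (r k)"] by (simp add: C_def divide_right_mono)
        thus ?thesis by (simp only: L2_norm_minus_commute)
      qed
      finally show "L2_norm M (\<lambda>y. F (T y) - F y)
        \<le> L2_norm M (\<lambda>y. g (r k) y - F y) + (2 * C / real (r k) + L2_norm M (\<lambda>y. g (r k) y - F y))"
        by simp
    qed
  qed
  hence "(\<integral>y. (F (T y) - F y)\<^sup>2 \<partial>M) = 0" by (simp add: L2_norm_def real_sqrt_le_0_iff antisym)
  hence inv: "AE y in M. F (T y) = F y"
    using square_integrable_diff[OF FT F]
    by (subst (asm) integral_nonneg_eq_0_iff_AE) (auto simp: square_integrable_def)
  have g_mean: "(\<integral>y. g n y \<partial>M) = 0" for n
  proof -
    have "(\<integral>y. f ((T ^^ j) y) \<partial>M) = 0" for j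
      using measure_preserving_integral[OF measure_preserving_funpow[OF mp], of f j] f mean
      by (simp add: square_integrable_def)
    thus ?thesis unfolding g_def[abs_def]
      using square_integrable_integrable[OF square_integrable_funpow[OF f]] by simp
  qed
  have F_mean: "(\<integral>y. F y \<partial>M) = 0"
  proof -
    have "\<bar>\<integral>y. F y \<partial>M\<bar> \<le> L2_norm M (\<lambda>y. g (r k) y - F y)" for k
    proof -
      have "\<bar>\<integral>y. F y \<partial>M\<bar> = \<bar>\<integral>y. g (r k) y - F y \<partial>M\<bar>"
        using square_integrable_integrable[OF F] square_integrable_integrable[OF g]
        by (simp add: g_mean)
      also have "\<dots> \<le> (\<integral>y. \<bar>g (r k) y - F y\<bar> \<partial>M)" by (rule integral_abs_bound)
      also have "\<dots> \<le> L2_norm M (\<lambda>y. g (r k) y - F y)"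
        by (intro expectation_abs_le_L2_norm square_integrable_diff g F)
      finally show ?thesis .
    qed
    hence "\<bar>\<integral>y. F y \<partial>M\<bar> \<le> 0" by (intro LIMSEQ_le_const[OF F_lim]) auto
    thus ?thesis by simp
  qed
  have "AE y in M. F y = 0"
    by (rule ergodic_invariant_eq_zero[OF erg square_integrable_integrable[OF F] inv F_mean])
  hence "L2_norm M (\<lambda>y. g (r k) y - F y) = b (r k)" for k
    unfolding b_def using square_integrable_diff[OF g F] g
    by (intro L2_norm_cong_AE) (auto elim: eventually_mono)
  hence "(\<lambda>k. b (r k)) \<longlonglongrightarrow> 0" using F_lim by simp
  moreover have "(\<lambda>k. b (r k)) \<longlonglongrightarrow> \<mu>" by (rule filterlim_compose[OF b_lim r_lim])
  ultimately have "\<mu> = 0" by (rule LIMSEQ_unique[symmetric])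
  with b_lim show ?thesis by (simp add: b_def[abs_def] g_def[abs_def])
qed

end

section \<open>The central limit theorem on the kernel of the transfer operator\<close>

lemma norm_iexp_diff_le: "cmod (iexp a - iexp b) \<le> \<bar>a - b\<bar>"
proof -
  have "iexp a - iexp b = iexp b * (iexp (a - b) - 1)"
    by (simp add: right_diff_distrib exp_add[symmetric] algebra_simps)
  hence "cmod (iexp a - iexp b) = cmod (iexp (a - b) - 1)" by (simp add: norm_mult)
  also have "\<dots> \<le> \<bar>a - b\<bar>" using iexp_approx1[of "a - b" 0] by simp
  finally show ?thesis .
qed

text \<open>
  The factor that replaces \<open>exp(i x)\<close> in McLeish's proof: the logarithm of \<open>1 + i x\<close> is
  \<open>i x + x\<^sup>2/2 + O(x\<^sup>3)\<close>, and the Gaussian factor removes the quadratic term.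
\<close>

definition mcleish :: "real \<Rightarrow> complex" where
  "mcleish x = (1 + \<i> * complex_of_real x) * complex_of_real (exp (- x\<^sup>2 / 2))"

lemma norm_one_plus_imaginary: "cmod (1 + \<i> * complex_of_real x) \<le> exp (x\<^sup>2 / 2)"
proof (rule power2_le_imp_le)
  have "(cmod (1 + \<i> * complex_of_real x))\<^sup>2 = 1 + x\<^sup>2" by (simp add: cmod_power2)
  also have "\<dots> \<le> exp (x\<^sup>2)" by (rule exp_ge_add_one_self)
  also have "\<dots> = (exp (x\<^sup>2 / 2))\<^sup>2" by (simp add: power2_eq_square flip: exp_add)
  finally show "(cmod (1 + \<i> * complex_of_real x))\<^sup>2 \<le> (exp (x\<^sup>2 / 2))\<^sup>2" .
qed simp

text \<open>
  This bound makes products of the factors comparable term by term with products of \<open>exp(i x)\<close>.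
\<close>

lemma norm_mcleish_le_one: "cmod (mcleish x) \<le> 1"
proof -
  have "cmod (mcleish x) \<le> exp (x\<^sup>2 / 2) * exp (- x\<^sup>2 / 2)"
    unfolding mcleish_def norm_mult by (intro mult_mono norm_one_plus_imaginary) auto
  also have "\<dots> = 1" by (simp flip: exp_add)
  finally show ?thesis .
qed

lemma iexp_mcleish_approx:
  assumes x: "\<bar>x\<bar> \<le> 1"
  shows "cmod (iexp x - mcleish x) \<le> 2 * \<bar>x\<bar> ^ 3"
proof -
  define u where "u = x\<^sup>2 / 2"
  define d where "d = exp (- u) - 1 + u"
  have u0: "0 \<le> u" by (simp add: u_def)
  have "1 - u \<le> exp (- u)" using exp_ge_add_one_self[of "- u"] by simp
  hence d0: "0 \<le> d" by (simp add: d_def)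
  have "exp (- u) \<le> 1 / (1 + u)"
    using exp_ge_add_one_self[of u] u0 by (simp add: exp_minus field_simps)
  \<comment> \<open>\<open>(1 - u + u\<^sup>2) (1 + u) = 1 + u\<^sup>3\<close>\<close>
  also have "\<dots> \<le> 1 - u + u\<^sup>2"
  proof -
    have "1 \<le> (1 - u + u\<^sup>2) * (1 + u)" using u0 by (simp add: algebra_simps power2_eq_square)
    thus ?thesis using u0 by (simp add: pos_divide_le_eq)
  qed
  finally have du: "d \<le> u\<^sup>2" by (simp add: d_def)
  have taylor: "cmod (iexp x - (1 + \<i> * x - x\<^sup>2 / 2)) \<le> \<bar>x\<bar> ^ 3 / 6"
    using iexp_approx1[of x 2]
    by (simp add: numeral_2_eq_2 numeral_3_eq_3 power2_eq_square field_simps)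
  have one: "cmod (1 + \<i> * complex_of_real x) \<le> 2"
    using norm_triangle_ineq[of 1 "\<i> * complex_of_real x"] x by (simp add: norm_mult)
  have "mcleish x - (1 + \<i> * x - x\<^sup>2 / 2)
      = (1 + \<i> * complex_of_real x) * of_real d - \<i> * of_real (x ^ 3 / 2)"
    by (simp add: mcleish_def d_def u_def algebra_simps power2_eq_square power3_eq_cube)
  also have "cmod \<dots> \<le> cmod ((1 + \<i> * complex_of_real x) * of_real d) + cmod (\<i> * of_real (x ^ 3 / 2))"
    by (rule norm_triangle_ineq4)
  also have "cmod ((1 + \<i> * complex_of_real x) * of_real d) \<le> 2 * u\<^sup>2"
    unfolding norm_mult using one du d0 by (intro mult_mono) auto
  also have "cmod (\<i> * of_real (x ^ 3 / 2)) = \<bar>x\<bar> ^ 3 / 2"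
    by (simp add: norm_mult norm_divide norm_power)
  also have "2 * u\<^sup>2 \<le> \<bar>x\<bar> ^ 3 / 2"
  proof -
    have "2 * u\<^sup>2 = \<bar>x\<bar> ^ 3 * \<bar>x\<bar> / 2"
      by (simp add: u_def power2_eq_square power3_eq_cube)
    also have "\<dots> \<le> \<bar>x\<bar> ^ 3 * 1 / 2" using x by (intro divide_right_mono mult_left_mono) auto
    finally show ?thesis by simp
  qed
  finally have "cmod (mcleish x - (1 + \<i> * x - x\<^sup>2 / 2)) \<le> \<bar>x\<bar> ^ 3" by simp
  hence "cmod (iexp x - mcleish x) \<le> \<bar>x\<bar> ^ 3 / 6 + \<bar>x\<bar> ^ 3"
    using norm_triangle_ineq4[of "iexp x - (1 + \<i> * x - x\<^sup>2 / 2)" "mcleish x - (1 + \<i> * x - x\<^sup>2 / 2)"] taylor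
    by simp
  also have "\<dots> \<le> 2 * \<bar>x\<bar> ^ 3" by simp
  finally show ?thesis .
qed

lemma exp_neg_lipschitz:
  fixes a b :: real
  assumes "0 \<le> a" "0 \<le> b"
  shows "\<bar>exp (- a) - exp (- b)\<bar> \<le> \<bar>a - b\<bar>"
proof -
  have *: "exp (- a) - exp (- b) \<le> b - a" if "0 \<le> a" "a \<le> b" for a b :: real
  proof -
    have "exp (- a) - exp (- b) = exp (- a) * (1 - exp (- (b - a)))"
      by (simp add: right_diff_distrib flip: exp_add)
    also have "\<dots> \<le> 1 * (b - a)"
    proof (intro mult_mono)
      show "1 - exp (- (b - a)) \<le> b - a"
        using exp_ge_add_one_self[of "- (b - a)"] by linarith
    qed (use that in auto)
    finally show ?thesis by simp
  qed
  show ?thesis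
    using *[of a b] *[of b a] assms by (cases "a \<le> b") (auto simp: abs_if)
qed

context measure_preserving_system
begin

text \<open>
  The adjoint identity with \<open>P d = 0\<close>, applied to real and imaginary parts.
\<close>

lemma kernel_orthogonal_complex:
  fixes G :: "'a \<Rightarrow> complex"
  assumes d: "square_integrable M d" and tr: "is_transfer M T d (\<lambda>y. 0)"
    and G [measurable]: "G \<in> borel_measurable M" and bd: "\<And>y. cmod (G y) \<le> K"
  shows "integrable M (\<lambda>y. complex_of_real (d y) * G (T y))"
    and "(\<integral>y. complex_of_real (d y) * G (T y) \<partial>M) = 0"
proof -
  note di = square_integrable_integrable[OF d]
  have [measurable]: "d \<in> borel_measurable M" using d by (simp add: square_integrable_def)
  show int: "integrable M (\<lambda>y. complex_of_real (d y) * G (T y))"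
  proof (rule Bochner_Integration.integrable_bound)
    show "integrable M (\<lambda>y. K * d y)" using di by simp
    show "AE y in M. cmod (complex_of_real (d y) * G (T y)) \<le> norm (K * d y)"
    proof (rule AE_I2)
      fix y
      have "cmod (G (T y)) \<le> \<bar>K\<bar>" using bd[of "T y"] by linarith
      thus "cmod (complex_of_real (d y) * G (T y)) \<le> norm (K * d y)"
        by (simp add: norm_mult abs_mult mult_mono mult.commute[of "\<bar>d y\<bar>"] mult_right_mono)
    qed
  qed measurable
  have "square_integrable M (\<lambda>y. Re (G y))" "square_integrable M (\<lambda>y. Im (G y))"
    using abs_Re_le_cmod abs_Im_le_cmod bd
    by (auto intro!: square_integrable_bounded_measurable[OF prob_space_axioms, of _ K]
        intro: order_trans)
  note orth = this[THEN is_transfer_adjoint[OF d tr]]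
  show "(\<integral>y. complex_of_real (d y) * G (T y) \<partial>M) = 0"
  proof (rule complex_eqI)
    show "Re (\<integral>y. complex_of_real (d y) * G (T y) \<partial>M) = Re 0"
      using orth(1) integral_Re[OF int] by simp
    show "Im (\<integral>y. complex_of_real (d y) * G (T y) \<partial>M) = Im 0"
      using orth(2) integral_Im[OF int] by simp
  qed
qed

text \<open>
  In the product for \<open>n + 1\<close> the factor with \<open>j = 0\<close> is \<open>1 + i\<theta>d\<close> and the others form a bounded
  function of \<open>T y\<close>. That function is orthogonal to \<open>d\<close>, so only the \<open>1\<close> survives and the
  invariance of the measure gives the product for \<open>n\<close>.
\<close>

lemma expectation_product_kernel:
  assumes [measurable]: "d \<in> borel_measurable M" and bd: "\<And>y. \<bar>d y\<bar> \<le> C"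
    and tr: "is_transfer M T d (\<lambda>y. 0)"
  shows "(\<integral>y. (\<Prod>j<n. 1 + \<i> * complex_of_real (\<theta> * d ((T ^^ j) y))) \<partial>M) = 1"
proof (induction n)
  case 0
  show ?case by (simp add: prob_space)
next
  case (Suc n)
  define G where "G y = (\<Prod>j<n. 1 + \<i> * complex_of_real (\<theta> * d ((T ^^ j) y)))" for y
  have [measurable]: "G \<in> borel_measurable M" unfolding G_def[abs_def] by measurable
  have d: "square_integrable M d"
    by (rule square_integrable_bounded_measurable[OF prob_space_axioms _ bd]) simp
  have "cmod (G y) \<le> (1 + \<bar>\<theta>\<bar> * C) ^ n" for y
  proof -
    have "cmod (G y) \<le> (\<Prod>j<n. 1 + \<bar>\<theta>\<bar> * C)"
      unfolding G_def prod_norm[symmetric]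
    proof (intro prod_mono conjI norm_ge_zero)
      fix j
      have "cmod (1 + \<i> * complex_of_real (\<theta> * d ((T ^^ j) y))) \<le> 1 + \<bar>\<theta>\<bar> * \<bar>d ((T ^^ j) y)\<bar>"
        using norm_triangle_ineq[of 1 "\<i> * complex_of_real (\<theta> * d ((T ^^ j) y))"]
        by (simp add: norm_mult)
      also have "\<dots> \<le> 1 + \<bar>\<theta>\<bar> * C" using bd by (intro add_left_mono mult_left_mono) auto
      finally show "cmod (1 + \<i> * complex_of_real (\<theta> * d ((T ^^ j) y))) \<le> 1 + \<bar>\<theta>\<bar> * C" .
    qed
    thus ?thesis by simp
  qed
  note G_bd = this
  have orth: "integrable M (\<lambda>y. complex_of_real (d y) * G (T y))"
    "(\<integral>y. complex_of_real (d y) * G (T y) \<partial>M) = 0"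
    using kernel_orthogonal_complex[where G=G, OF d tr _ G_bd] by simp_all
  have Gi: "integrable M (\<lambda>y. G (T y))"
    by (intro integrable_const_bound[where B="(1 + \<bar>\<theta>\<bar> * C) ^ n"]) (auto simp: G_bd)
  have "(\<Prod>j<Suc n. 1 + \<i> * complex_of_real (\<theta> * d ((T ^^ j) y)))
      = G (T y) + \<i> * complex_of_real \<theta> * (complex_of_real (d y) * G (T y))" for y
    unfolding prod.lessThan_Suc_shift G_def by (simp add: funpow_swap1 algebra_simps)
  hence "(\<integral>y. (\<Prod>j<Suc n. 1 + \<i> * complex_of_real (\<theta> * d ((T ^^ j) y))) \<partial>M)
      = (\<integral>y. G (T y) \<partial>M) + \<i> * complex_of_real \<theta> * (\<integral>y. complex_of_real (d y) * G (T y) \<partial>M)"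
    using Gi orth(1) by simp
  also have "\<dots> = (\<integral>y. G y \<partial>M)"
    using orth(2) measure_preserving_integral[OF mp, of G] by simp
  finally show ?case using Suc by (simp add: G_def[abs_def])
qed

text \<open>
  Put \<open>x\<^sub>j = t d(T\<^sup>j y) / \<surd>n\<close>. Replacing each \<open>exp(i x\<^sub>j)\<close> by \<open>(1 + i x\<^sub>j) exp(-x\<^sub>j\<^sup>2/2)\<close> costs \<open>n\<close>
  terms of order \<open>n\<^sup>-\<^sup>3\<^sup>/\<^sup>2\<close>. The exponent is now \<open>-t\<^sup>2/2\<close> times an ergodic average of \<open>d\<^sup>2\<close>, which
  may be replaced by its limit since the remaining product is bounded and the convergence holds in
  \<open>L\<^sup>1\<close>. What is left is that limit times the expectation of the product, which is one.
\<close>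

lemma clt_bounded_kernel:
  assumes erg: "ergodic M T"
    and d [measurable]: "d \<in> borel_measurable M" and bd: "\<And>y. \<bar>d y\<bar> \<le> C"
    and tr: "is_transfer M T d (\<lambda>y. 0)"
  shows "(\<lambda>n. \<integral>y. iexp (t * ((1 / sqrt (real n)) * (\<Sum>j<n. d ((T ^^ j) y)))) \<partial>M)
    \<longlonglongrightarrow> complex_of_real (exp (- (t\<^sup>2 * (L2_norm M d)\<^sup>2 / 2)))"
proof -
  define v where "v = (L2_norm M d)\<^sup>2"
  define E where "E = complex_of_real (exp (- (t\<^sup>2 * v / 2)))"
  define Q where "Q n y = (1 / real n) * (\<Sum>j<n. (d ((T ^^ j) y))\<^sup>2 - v)" for n y
  define K where "K = exp (t\<^sup>2 * C\<^sup>2 / 2)"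
  \<comment> \<open>The type has an element, so any value of \<open>d\<close> shows that the bound is nonnegative.\<close>
  have C0: "0 \<le> C" using bd[of undefined] by linarith
  have v0: "0 \<le> v" by (simp add: v_def)
  have d2: "(d y)\<^sup>2 \<le> C\<^sup>2" for y
    using power_mono[OF bd[of y], of 2] by simp
  have dsq: "square_integrable M d"
    by (rule square_integrable_bounded_measurable[OF prob_space_axioms _ bd]) simp
  have d2sq: "square_integrable M (\<lambda>y. (d y)\<^sup>2 - v)"
  proof (rule square_integrable_bounded_measurable[OF prob_space_axioms])
    show "\<bar>(d y)\<^sup>2 - v\<bar> \<le> C\<^sup>2 + v" for y
      using d2[of y] v0 by (simp add: abs_le_iff add_increasing2 add_increasing)
  qed simp
  have Qsq: "square_integrable M (Q n)" for n
    unfolding Q_def[abs_def]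
    using square_integrable_birkhoff_sum[OF d2sq, of n] by (rule square_integrable_scale)
  have "(\<integral>y. (d y)\<^sup>2 - v \<partial>M) = 0"
    using dsq by (simp add: square_integrable_def v_def L2_norm_power2 prob_space)
  note Q_lim = mean_ergodic_theorem[OF erg d2sq this, folded Q_def]
  have bound: "cmod ((\<integral>y. iexp (t * ((1 / sqrt (real n)) * (\<Sum>j<n. d ((T ^^ j) y)))) \<partial>M) - E)
      \<le> 2 * \<bar>t * C\<bar> ^ 3 / sqrt n + K * (t\<^sup>2 / 2 * L2_norm M (Q n))"
    if n: "0 < n" "\<bar>t * C\<bar> \<le> sqrt n" for n
  proof -
    define \<theta> where "\<theta> = t / sqrt n"
    define x where "x j y = \<theta> * d ((T ^^ j) y)" for j y
    define G where "G y = (\<Prod>j<n. 1 + \<i> * complex_of_real (x j y))" for y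
    have [measurable]: "x j \<in> borel_measurable M" for j unfolding x_def[abs_def] by measurable
    have [measurable]: "G \<in> borel_measurable M" unfolding G_def[abs_def] by measurable
    have x_le: "\<bar>x j y\<bar> \<le> \<bar>t * C\<bar> / sqrt n" for j y
    proof -
      have "\<bar>x j y\<bar> = \<bar>t\<bar> * \<bar>d ((T ^^ j) y)\<bar> / sqrt n" by (simp add: x_def \<theta>_def abs_mult)
      also have "\<dots> \<le> \<bar>t\<bar> * C / sqrt n" using bd by (intro divide_right_mono mult_left_mono) auto
      finally show ?thesis using C0 by (simp add: abs_mult)
    qed
    have x1: "\<bar>x j y\<bar> \<le> 1" for j y
      using x_le[of j y] n by (rule_tac order_trans) (auto simp: divide_le_eq)
    have sum_x2: "(\<Sum>j<n. (x j y)\<^sup>2) = t\<^sup>2 * (Q n y + v)" for y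
      using n by (simp add: x_def \<theta>_def Q_def power_mult_distrib power_divide sum_distrib_left[symmetric]
          sum_divide_distrib[symmetric] sum_subtractf field_simps)
    have G_le: "cmod (G y) \<le> K" for y
    proof -
      have "cmod (G y) \<le> (\<Prod>j<n. exp ((x j y)\<^sup>2 / 2))"
        unfolding G_def prod_norm[symmetric] by (intro prod_mono conjI norm_ge_zero norm_one_plus_imaginary)
      also have "\<dots> \<le> (\<Prod>j<n. exp ((t\<^sup>2 * C\<^sup>2 / n) / 2))"
      proof (intro prod_mono conjI)
        fix j
        have "(x j y)\<^sup>2 \<le> (\<bar>t * C\<bar> / sqrt n)\<^sup>2" using power_mono[OF x_le[of j y], of 2] by simp
        thus "exp ((x j y)\<^sup>2 / 2) \<le> exp ((t\<^sup>2 * C\<^sup>2 / n) / 2)"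
          by (simp add: power_divide power_mult_distrib)
      qed simp
      also have "\<dots> = K" using n by (simp add: K_def flip: exp_of_nat_mult)
      finally show ?thesis .
    qed
    have pointwise: "cmod (iexp (t * ((1 / sqrt (real n)) * (\<Sum>j<n. d ((T ^^ j) y)))) - G y * E)
        \<le> 2 * \<bar>t * C\<bar> ^ 3 / sqrt n + K * (t\<^sup>2 / 2 * \<bar>Q n y\<bar>)" for y
    proof -
      have "t * ((1 / sqrt (real n)) * (\<Sum>j<n. d ((T ^^ j) y))) = (\<Sum>j<n. x j y)"
        by (simp add: x_def \<theta>_def sum_distrib_left)
      hence iexp_prod: "iexp (t * ((1 / sqrt (real n)) * (\<Sum>j<n. d ((T ^^ j) y)))) = (\<Prod>j<n. iexp (x j y))"
        by (simp add: sum_distrib_left exp_sum)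
      have "cmod ((\<Prod>j<n. iexp (x j y)) - (\<Prod>j<n. mcleish (x j y))) \<le> (\<Sum>j<n. cmod (iexp (x j y) - mcleish (x j y)))"
        by (intro norm_prod_diff) (auto simp: norm_mcleish_le_one)
      also have "\<dots> \<le> (\<Sum>j<n. 2 * (\<bar>t * C\<bar> / sqrt n) ^ 3)"
        by (intro sum_mono order_trans[OF iexp_mcleish_approx[OF x1]] mult_left_mono power_mono x_le) auto
      also have "\<dots> = 2 * \<bar>t * C\<bar> ^ 3 / sqrt n"
        using n by (simp add: power_divide power3_eq_cube)
      finally have 1: "cmod ((\<Prod>j<n. iexp (x j y)) - (\<Prod>j<n. mcleish (x j y))) \<le> 2 * \<bar>t * C\<bar> ^ 3 / sqrt n" .
      have "(\<Prod>j<n. exp (- (x j y)\<^sup>2 / 2)) = exp (- (t\<^sup>2 * (Q n y + v) / 2))"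
        by (simp add: exp_sum[symmetric] sum_negf sum_divide_distrib[symmetric] sum_x2)
      hence "(\<Prod>j<n. mcleish (x j y)) = G y * complex_of_real (exp (- (t\<^sup>2 * (Q n y + v) / 2)))"
        unfolding mcleish_def prod.distrib G_def of_real_prod[symmetric] by simp
      hence "cmod ((\<Prod>j<n. mcleish (x j y)) - G y * E)
          = cmod (G y) * \<bar>exp (- (t\<^sup>2 * (Q n y + v) / 2)) - exp (- (t\<^sup>2 * v / 2))\<bar>"
        unfolding E_def by (simp add: norm_mult flip: right_diff_distrib of_real_diff)
      also have "\<dots> \<le> K * (t\<^sup>2 / 2 * \<bar>Q n y\<bar>)"
      proof (intro mult_mono G_le)
        have "\<bar>exp (- (t\<^sup>2 * (Q n y + v) / 2)) - exp (- (t\<^sup>2 * v / 2))\<bar>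
            \<le> \<bar>t\<^sup>2 * (Q n y + v) / 2 - t\<^sup>2 * v / 2\<bar>"
          using v0 unfolding sum_x2[symmetric] by (intro exp_neg_lipschitz) (auto intro: sum_nonneg)
        also have "t\<^sup>2 * (Q n y + v) / 2 - t\<^sup>2 * v / 2 = t\<^sup>2 / 2 * Q n y" by (simp add: algebra_simps)
        finally show "\<bar>exp (- (t\<^sup>2 * (Q n y + v) / 2)) - exp (- (t\<^sup>2 * v / 2))\<bar> \<le> t\<^sup>2 / 2 * \<bar>Q n y\<bar>"
          by (simp add: abs_mult)
      qed (auto simp: K_def)
      finally have 2: "cmod ((\<Prod>j<n. mcleish (x j y)) - G y * E) \<le> K * (t\<^sup>2 / 2 * \<bar>Q n y\<bar>)" .
      show ?thesis unfolding iexp_prod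
        using norm_diff_triangle_le[OF 1 2] .
    qed
    have Gi: "integrable M G"
      by (intro integrable_const_bound[where B=K]) (auto simp: G_le)
    have "(\<integral>y. G y \<partial>M) = 1"
      unfolding G_def x_def by (rule expectation_product_kernel[OF d bd tr])
    hence "(\<integral>y. G y * E \<partial>M) = E" by simp
    moreover have ii: "integrable M (\<lambda>y. iexp (t * ((1 / sqrt (real n)) * (\<Sum>j<n. d ((T ^^ j) y)))))"
      by (intro integrable_const_bound[where B=1]) auto
    ultimately have "cmod ((\<integral>y. iexp (t * ((1 / sqrt (real n)) * (\<Sum>j<n. d ((T ^^ j) y)))) \<partial>M) - E)
        = cmod (\<integral>y. iexp (t * ((1 / sqrt (real n)) * (\<Sum>j<n. d ((T ^^ j) y)))) - G y * E \<partial>M)"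
      using Gi by (subst Bochner_Integration.integral_diff) auto
    also have "\<dots> \<le> (\<integral>y. cmod (iexp (t * ((1 / sqrt (real n)) * (\<Sum>j<n. d ((T ^^ j) y)))) - G y * E) \<partial>M)"
      by (rule integral_norm_bound)
    also have "\<dots> \<le> (\<integral>y. 2 * \<bar>t * C\<bar> ^ 3 / sqrt n + K * (t\<^sup>2 / 2 * \<bar>Q n y\<bar>) \<partial>M)"
      using pointwise ii Gi square_integrable_integrable[OF Qsq]
      by (intro integral_mono integrable_norm Bochner_Integration.integrable_diff) auto
    also have "\<dots> = 2 * \<bar>t * C\<bar> ^ 3 / sqrt n + K * (t\<^sup>2 / 2 * (\<integral>y. \<bar>Q n y\<bar> \<partial>M))"
      using square_integrable_integrable[OF Qsq] by (simp add: prob_space)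
    also have "\<dots> \<le> 2 * \<bar>t * C\<bar> ^ 3 / sqrt n + K * (t\<^sup>2 / 2 * L2_norm M (Q n))"
      by (intro add_left_mono mult_left_mono expectation_abs_le_L2_norm Qsq) (auto simp: K_def)
    finally show ?thesis .
  qed
  have sqrt_top: "filterlim (\<lambda>n. sqrt (real n)) at_top sequentially"
    by (intro filterlim_compose[OF sqrt_at_top] filterlim_real_sequentially)
  have "(\<lambda>n. (\<integral>y. iexp (t * ((1 / sqrt (real n)) * (\<Sum>j<n. d ((T ^^ j) y)))) \<partial>M) - E) \<longlonglongrightarrow> 0"
  proof (rule Lim_null_comparison)
    show "\<forall>\<^sub>F n in sequentially. cmod ((\<integral>y. iexp (t * ((1 / sqrt (real n)) * (\<Sum>j<n. d ((T ^^ j) y)))) \<partial>M) - E)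
        \<le> 2 * \<bar>t * C\<bar> ^ 3 / sqrt n + K * (t\<^sup>2 / 2 * L2_norm M (Q n))"
      using eventually_gt_at_top[of 0] filterlim_at_top[THEN iffD1, OF sqrt_top, rule_format, of "\<bar>t * C\<bar>"]
      by eventually_elim (rule bound)
    have "(\<lambda>n. 2 * \<bar>t * C\<bar> ^ 3 / sqrt (real n)) \<longlonglongrightarrow> 0"
      by (intro tendsto_divide_0[OF tendsto_const] filterlim_at_top_imp_at_infinity sqrt_top)
    moreover have "(\<lambda>n. K * (t\<^sup>2 / 2 * L2_norm M (Q n))) \<longlonglongrightarrow> K * (t\<^sup>2 / 2 * 0)"
      using Q_lim by (intro tendsto_intros) (simp add: Q_def[abs_def])
    ultimately have "(\<lambda>n. 2 * \<bar>t * C\<bar> ^ 3 / sqrt (real n) + K * (t\<^sup>2 / 2 * L2_norm M (Q n)))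
        \<longlonglongrightarrow> 0 + K * (t\<^sup>2 / 2 * 0)"
      by (rule tendsto_add)
    thus "(\<lambda>n. 2 * \<bar>t * C\<bar> ^ 3 / sqrt (real n) + K * (t\<^sup>2 / 2 * L2_norm M (Q n))) \<longlonglongrightarrow> 0"
      by simp
  qed
  thus ?thesis unfolding E_def v_def by (simp only: LIM_zero_iff)
qed

text \<open>
  Truncating \<open>d\<close> destroys \<open>P d = 0\<close>; applying the projection \<open>1 - U P\<close> to the truncation \<open>c\<close>
  restores it. As \<open>d\<close> is fixed by this projection, the error does not exceed \<open>\<parallel>d - c\<parallel>\<close>.
\<close>

lemma kernel_bounded_approximation:
  assumes d: "square_integrable M d" and tr: "is_transfer M T d (\<lambda>y. 0)" and e: "0 < e"
  obtains C d' where "d' \<in> borel_measurable M" "\<And>y. \<bar>d' y\<bar> \<le> C" "is_transfer M T d' (\<lambda>y. 0)"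
    "L2_norm M (\<lambda>y. d y - d' y) < e"
proof -
  have [measurable]: "d \<in> borel_measurable M" using d by (simp add: square_integrable_def)
  define c where "c k y = max (- real k) (min (real k) (d y))" for k y
  have [measurable]: "c k \<in> borel_measurable M" for k unfolding c_def[abs_def] by measurable
  have c_le: "\<bar>c k y\<bar> \<le> real k" for k y by (auto simp: c_def max_def min_def)
  have c: "square_integrable M (c k)" for k
    by (rule square_integrable_bounded_measurable[OF prob_space_axioms _ c_le]) simp
  have "(\<lambda>k. \<integral>y. (d y - c k y)\<^sup>2 \<partial>M) \<longlonglongrightarrow> (\<integral>y. 0 \<partial>M)"
  proof (rule integral_dominated_convergence[where w="\<lambda>y. (d y)\<^sup>2"])
    show "integrable M (\<lambda>y. (d y)\<^sup>2)" using d by (simp add: square_integrable_def)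
    show "AE y in M. (\<lambda>k. (d y - c k y)\<^sup>2) \<longlonglongrightarrow> 0"
    proof (rule AE_I2)
      fix y
      obtain k0 :: nat where k0: "\<bar>d y\<bar> \<le> real k0" using real_arch_simple by blast
      show "(\<lambda>k. (d y - c k y)\<^sup>2) \<longlonglongrightarrow> 0"
      proof (rule tendsto_eventually, rule eventually_sequentiallyI)
        fix k assume "k0 \<le> k"
        hence "\<bar>d y\<bar> \<le> real k" using k0 by linarith
        hence "d y \<le> real k" "- real k \<le> d y" by linarith+
        hence "c k y = d y" unfolding c_def by (simp only: min_absorb2 max_absorb2)
        thus "(d y - c k y)\<^sup>2 = 0" by simp
      qed
    qed
    show "AE y in M. norm ((d y - c k y)\<^sup>2) \<le> (d y)\<^sup>2" for k
    proof (rule AE_I2)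
      fix y
      have "\<bar>d y - c k y\<bar> \<le> \<bar>d y\<bar>" by (auto simp: c_def max_def min_def)
      thus "norm ((d y - c k y)\<^sup>2) \<le> (d y)\<^sup>2" by (simp add: abs_le_square_iff)
    qed
  qed measurable
  hence "(\<lambda>k. L2_norm M (\<lambda>y. d y - c k y)) \<longlonglongrightarrow> sqrt 0"
    unfolding L2_norm_def by (intro tendsto_intros) simp
  hence "eventually (\<lambda>k. L2_norm M (\<lambda>y. d y - c k y) < e) sequentially"
    using e by (intro order_tendstoD(2)) auto
  then obtain k where k: "L2_norm M (\<lambda>y. d y - c k y) < e"
    unfolding eventually_sequentially by blast
  have "c k \<in> borel_measurable M" by simp
  then obtain g where g: "is_transfer M T (c k) g" "\<And>y. \<bar>g y\<bar> \<le> real k"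
    using is_transfer_bounded[where f="c k", OF _ c_le] by blast
  have [measurable]: "g \<in> borel_measurable M" using g(1) by (auto simp: is_transfer_def)
  define d' where "d' y = c k y - g (T y)" for y
  have dc: "square_integrable M (\<lambda>y. d y - c k y)" by (intro square_integrable_diff d c)
  have trdc: "is_transfer M T (\<lambda>y. d y - c k y) (\<lambda>y. 0 - g y)"
    using d c by (intro is_transfer_diff tr g square_integrable_integrable)
  have "(L2_norm M (\<lambda>y. d y - d' y))\<^sup>2 \<le> (L2_norm M (\<lambda>y. d y - c k y))\<^sup>2"
  proof -
    have "d y - d' y = (d y - c k y) - (0 - g (T y))" for y by (simp add: d'_def)
    hence "(L2_norm M (\<lambda>y. d y - d' y))\<^sup>2 = (L2_norm M (\<lambda>y. d y - c k y))\<^sup>2 - (L2_norm M (\<lambda>y. 0 - g y))\<^sup>2"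
      using is_transfer_residual_norm[OF dc trdc] by (simp only:)
    thus ?thesis using zero_le_power2[of "L2_norm M (\<lambda>y. 0 - g y)"] by linarith
  qed
  hence "L2_norm M (\<lambda>y. d y - d' y) \<le> L2_norm M (\<lambda>y. d y - c k y)"
    by (rule power2_le_imp_le) simp
  with k have "L2_norm M (\<lambda>y. d y - d' y) < e" by linarith
  moreover have "d' \<in> borel_measurable M" unfolding d'_def[abs_def] by measurable
  moreover have "\<bar>d' y\<bar> \<le> real k + real k" for y
    using c_le[of k y] g(2)[of "T y"] unfolding d'_def by linarith
  moreover have "is_transfer M T d' (\<lambda>y. 0)"
    unfolding d'_def[abs_def] by (rule is_transfer_residual[OF c g(1)])
  ultimately show ?thesis using that by blast
qed

lemma expectation_iexp_diff_le:
  assumes X: "square_integrable M X" and Y: "square_integrable M Y"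
  shows "cmod ((\<integral>y. iexp (t * X y) \<partial>M) - (\<integral>y. iexp (t * Y y) \<partial>M)) \<le> \<bar>t\<bar> * L2_norm M (\<lambda>y. X y - Y y)"
proof -
  have [measurable]: "X \<in> borel_measurable M" "Y \<in> borel_measurable M"
    using assms by (auto simp: square_integrable_def)
  have int: "integrable M (\<lambda>y. iexp (t * X y))" "integrable M (\<lambda>y. iexp (t * Y y))"
    by (auto intro!: integrable_const_bound[where B=1])
  have XY: "square_integrable M (\<lambda>y. X y - Y y)" by (intro square_integrable_diff X Y)
  have "cmod ((\<integral>y. iexp (t * X y) \<partial>M) - (\<integral>y. iexp (t * Y y) \<partial>M))
      = cmod (\<integral>y. iexp (t * X y) - iexp (t * Y y) \<partial>M)"
    using int by simp
  also have "\<dots> \<le> (\<integral>y. cmod (iexp (t * X y) - iexp (t * Y y)) \<partial>M)"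
    by (rule integral_norm_bound)
  also have "\<dots> \<le> (\<integral>y. \<bar>t\<bar> * \<bar>X y - Y y\<bar> \<partial>M)"
  proof (rule integral_mono)
    show "integrable M (\<lambda>y. cmod (iexp (t * X y) - iexp (t * Y y)))"
      using int by (intro integrable_norm Bochner_Integration.integrable_diff)
    show "integrable M (\<lambda>y. \<bar>t\<bar> * \<bar>X y - Y y\<bar>)"
      using square_integrable_integrable[OF XY] by simp
    show "cmod (iexp (t * X y) - iexp (t * Y y)) \<le> \<bar>t\<bar> * \<bar>X y - Y y\<bar>" for y
      using norm_iexp_diff_le[of "t * X y" "t * Y y"] by (simp only: right_diff_distrib[symmetric] abs_mult)
  qed
  also have "\<dots> = \<bar>t\<bar> * (\<integral>y. \<bar>X y - Y y\<bar> \<partial>M)" by simp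
  also have "\<dots> \<le> \<bar>t\<bar> * L2_norm M (\<lambda>y. X y - Y y)"
    by (intro mult_left_mono expectation_abs_le_L2_norm XY) simp
  finally show ?thesis .
qed

end

lemma normal_distribution_real_distribution:
  assumes "0 < \<sigma>"
  shows "real_distribution (density lborel (normal_density 0 \<sigma>))"
  using prob_space_normal_density[OF assms, of 0]
  by (auto simp: real_distribution_def real_distribution_axioms_def)

lemma char_normal_distribution:
  assumes \<sigma>: "0 < \<sigma>"
  shows "char (density lborel (normal_density 0 \<sigma>)) t = complex_of_real (exp (- (t\<^sup>2 * \<sigma>\<^sup>2 / 2)))"
proof -
  interpret N: real_distribution std_normal_distribution by (rule real_dist_normal_dist)
  have "distributed std_normal_distribution lborel (\<lambda>x. x) std_normal_density"
    by (auto simp: distributed_def distr_id2)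
  hence "distributed std_normal_distribution lborel (\<lambda>x. 0 + \<sigma> * x) (normal_density (0 + \<sigma> * 0) (\<bar>\<sigma>\<bar> * 1))"
    using \<sigma> by (intro N.normal_density_affine) auto
  hence "density lborel (normal_density 0 \<sigma>) = distr std_normal_distribution lborel (\<lambda>x. \<sigma> * x)"
    using \<sigma> by (auto simp: distributed_def)
  hence "char (density lborel (normal_density 0 \<sigma>)) t = char std_normal_distribution (t * \<sigma>)"
    by (simp add: char_def integral_distr mult.assoc)
  thus ?thesis by (simp add: char_std_normal_distribution power_mult_distrib)
qed

context measure_preserving_system
begin

text \<open>
  Compare the characteristic function of the normalised sums of \<open>h\<close> with that for a bounded \<open>d'\<close>
  in the kernel with \<open>\<parallel>d - d'\<parallel> < s\<close>. The error from \<open>d\<close> to \<open>d'\<close> is at most \<open>\<bar>t\<bar> s\<close> for every \<open>n\<close>,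
  because \<open>d - d'\<close> is again in the kernel, and the Gaussian limits differ by a quantity that
  vanishes with \<open>s\<close>.
\<close>

lemma clt_from_kernel_approximation:
  assumes erg: "ergodic M T" and h: "square_integrable M h"
    and d: "square_integrable M d" and tr: "is_transfer M T d (\<lambda>y. 0)" and pos: "0 < L2_norm M d"
    and approx: "(\<lambda>n. L2_norm M (\<lambda>y. (1 / sqrt (real n)) * (\<Sum>j<n. h ((T ^^ j) y) - d ((T ^^ j) y)))) \<longlonglongrightarrow> 0"
  shows "CLT_holds M T h"
proof -
  define \<sigma> where "\<sigma> = L2_norm M d"
  define S where "S u n y = (1 / sqrt (real n)) * (\<Sum>j<n. u ((T ^^ j) y))" for u :: "'a \<Rightarrow> real" and n y
  have S: "square_integrable M (S u n)" if "square_integrable M u" for u n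
    unfolding S_def[abs_def] by (intro square_integrable_scale square_integrable_birkhoff_sum that)
  have S_diff: "S u n y - S w n y = S (\<lambda>y. u y - w y) n y" for u w n y
    by (simp add: S_def sum_subtractf right_diff_distrib)
  have "(\<lambda>n. \<integral>y. iexp (t * S h n y) \<partial>M) \<longlonglongrightarrow> complex_of_real (exp (- (t\<^sup>2 * \<sigma>\<^sup>2 / 2)))" for t
  proof (rule LIMSEQ_I)
    fix e :: real assume e: "0 < e"
    \<comment> \<open>The error from \<open>d\<close> to \<open>d'\<close>, plus a bound for the difference of the two Gaussian limits.\<close>
    have "((\<lambda>s. \<bar>t\<bar> * s + t\<^sup>2 / 2 * (s * (2 * \<sigma> + s))) \<longlongrightarrow> \<bar>t\<bar> * 0 + t\<^sup>2 / 2 * (0 * (2 * \<sigma> + 0))) (at_right 0)"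
      by (intro tendsto_intros)
    hence "eventually (\<lambda>s. \<bar>t\<bar> * s + t\<^sup>2 / 2 * (s * (2 * \<sigma> + s)) < e / 2) (at_right 0)"
      using e by (intro order_tendstoD(2)) auto
    hence "eventually (\<lambda>s. 0 < s \<and> \<bar>t\<bar> * s + t\<^sup>2 / 2 * (s * (2 * \<sigma> + s)) < e / 2) (at_right 0)"
      using eventually_at_right_less[of "0::real"] by eventually_elim simp
    then obtain s where s: "0 < s" "\<bar>t\<bar> * s + t\<^sup>2 / 2 * (s * (2 * \<sigma> + s)) < e / 2"
      using eventually_happens' trivial_limit_at_right_real by blast
    obtain C d' where d'm: "d' \<in> borel_measurable M" and d'C: "\<And>y. \<bar>d' y\<bar> \<le> C"
      and d'tr: "is_transfer M T d' (\<lambda>y. 0)" and d'close: "L2_norm M (\<lambda>y. d y - d' y) < s"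
      using kernel_bounded_approximation[OF d tr s(1)] by metis
    have d': "square_integrable M d'"
      by (rule square_integrable_bounded_measurable[OF prob_space_axioms d'm d'C])
    have dd': "square_integrable M (\<lambda>y. d y - d' y)" by (intro square_integrable_diff d d')
    have dd'tr: "is_transfer M T (\<lambda>y. d y - d' y) (\<lambda>y. 0)"
      using is_transfer_diff[OF tr d'tr] d d' by (simp add: square_integrable_integrable)
    have S_dd': "L2_norm M (\<lambda>y. S d n y - S d' n y) \<le> s" for n
      using L2_norm_birkhoff_sum_kernel[OF dd' dd'tr, of n] d'close s(1)
      unfolding S_diff unfolding S_def L2_norm_scale by (cases "n = 0") auto
    have sigma': "\<bar>(L2_norm M d')\<^sup>2 - \<sigma>\<^sup>2\<bar> \<le> s * (2 * \<sigma> + s)"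
    proof -
      have *: "\<bar>\<sigma> - L2_norm M d'\<bar> \<le> s"
        using L2_norm_reverse_triangle[OF d d'] d'close by (simp add: \<sigma>_def)
      have "\<bar>(L2_norm M d')\<^sup>2 - \<sigma>\<^sup>2\<bar> = \<bar>\<sigma> - L2_norm M d'\<bar> * (\<sigma> + L2_norm M d')"
        using pos by (simp add: \<sigma>_def power2_eq_square square_diff_square_factored abs_mult abs_minus_commute add.commute mult.commute)
      also have "\<dots> \<le> s * (2 * \<sigma> + s)"
        using * pos by (intro mult_mono) (auto simp: \<sigma>_def)
      finally show ?thesis .
    qed
    have gauss: "cmod (complex_of_real (exp (- (t\<^sup>2 * (L2_norm M d')\<^sup>2 / 2))) - complex_of_real (exp (- (t\<^sup>2 * \<sigma>\<^sup>2 / 2))))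
        \<le> t\<^sup>2 / 2 * (s * (2 * \<sigma> + s))"
    proof -
      have "cmod (complex_of_real (exp (- (t\<^sup>2 * (L2_norm M d')\<^sup>2 / 2))) - complex_of_real (exp (- (t\<^sup>2 * \<sigma>\<^sup>2 / 2))))
          = \<bar>exp (- (t\<^sup>2 * (L2_norm M d')\<^sup>2 / 2)) - exp (- (t\<^sup>2 * \<sigma>\<^sup>2 / 2))\<bar>"
        by (simp only: norm_of_real flip: of_real_diff)
      also have "\<dots> \<le> \<bar>t\<^sup>2 * (L2_norm M d')\<^sup>2 / 2 - t\<^sup>2 * \<sigma>\<^sup>2 / 2\<bar>"
        by (intro exp_neg_lipschitz) auto
      also have "\<dots> = t\<^sup>2 / 2 * \<bar>(L2_norm M d')\<^sup>2 - \<sigma>\<^sup>2\<bar>"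
        by (simp add: abs_mult flip: right_diff_distrib diff_divide_distrib)
      also have "\<dots> \<le> t\<^sup>2 / 2 * (s * (2 * \<sigma> + s))"
        by (intro mult_left_mono sigma') auto
      finally show ?thesis .
    qed
    define a where "a n = L2_norm M (\<lambda>y. S h n y - S d n y)" for n
    have "a \<longlonglongrightarrow> 0"
      using approx unfolding a_def S_diff unfolding S_def .
    hence "(\<lambda>n. \<bar>t\<bar> * a n) \<longlonglongrightarrow> \<bar>t\<bar> * 0" by (intro tendsto_intros)
    hence "eventually (\<lambda>n. \<bar>t\<bar> * a n < e / 4) sequentially"
      using e by (intro order_tendstoD(2)) auto
    then obtain n1 where n1: "\<And>n. n \<ge> n1 \<Longrightarrow> \<bar>t\<bar> * a n < e / 4"
      unfolding eventually_sequentially by blast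
    have "0 < e / 4" using e by simp
    from LIMSEQ_D[OF clt_bounded_kernel[OF erg d'm d'C d'tr, of t] this]
    obtain n2 where n2: "\<And>n. n \<ge> n2 \<Longrightarrow>
        cmod ((\<integral>y. iexp (t * S d' n y) \<partial>M) - complex_of_real (exp (- (t\<^sup>2 * (L2_norm M d')\<^sup>2 / 2)))) < e / 4"
      unfolding S_def by blast
    show "\<exists>no. \<forall>n\<ge>no. cmod ((\<integral>y. iexp (t * S h n y) \<partial>M) - complex_of_real (exp (- (t\<^sup>2 * \<sigma>\<^sup>2 / 2)))) < e"
    proof (intro exI allI impI)
      fix n assume n: "max n1 n2 \<le> n"
      have 1: "cmod ((\<integral>y. iexp (t * S h n y) \<partial>M) - (\<integral>y. iexp (t * S d' n y) \<partial>M)) \<le> \<bar>t\<bar> * (a n + s)"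
      proof (rule order_trans[OF expectation_iexp_diff_le[OF S[OF h] S[OF d']]])
        have "L2_norm M (\<lambda>y. S h n y - S d' n y) \<le> a n + s"
          using L2_norm_diff_triangle[OF S[OF h] S[OF d] S[OF d'], of n n n] S_dd'[of n] by (simp add: a_def)
        thus "\<bar>t\<bar> * L2_norm M (\<lambda>y. S h n y - S d' n y) \<le> \<bar>t\<bar> * (a n + s)"
          by (intro mult_left_mono) auto
      qed
      note 2 = norm_diff_triangle_le[OF norm_diff_triangle_le[OF 1 less_imp_le[OF n2]] gauss]
      have "cmod ((\<integral>y. iexp (t * S h n y) \<partial>M) - complex_of_real (exp (- (t\<^sup>2 * \<sigma>\<^sup>2 / 2))))
          \<le> \<bar>t\<bar> * (a n + s) + e / 4 + t\<^sup>2 / 2 * (s * (2 * \<sigma> + s))"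
        using 2 n by simp
      also have "\<dots> < e"
        using n1[of n] s(2) n by (simp add: distrib_left)
      finally show "cmod ((\<integral>y. iexp (t * S h n y) \<partial>M) - complex_of_real (exp (- (t\<^sup>2 * \<sigma>\<^sup>2 / 2)))) < e" .
    qed
  qed
  note conv = this
  have [measurable]: "S h n \<in> borel_measurable M" for n
    using S[OF h] by (simp add: square_integrable_def)
  have "weak_conv_m (\<lambda>n. distr M borel (S h n)) (density lborel (normal_density 0 \<sigma>))"
  proof (rule levy_continuity)
    show "real_distribution (distr M borel (S h n))" for n by (rule real_distribution_distr) simp
    show "real_distribution (density lborel (normal_density 0 \<sigma>))"
      using pos by (intro normal_distribution_real_distribution) (simp add: \<sigma>_def)
    show "(\<lambda>n. char (distr M borel (S h n)) t) \<longlonglongrightarrow> char (density lborel (normal_density 0 \<sigma>)) t" for t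
    proof -
      have "char (distr M borel (S h n)) t = (\<integral>y. iexp (t * S h n y) \<partial>M)" for n
        by (simp add: char_def integral_distr)
      moreover have "0 < \<sigma>" using pos by (simp add: \<sigma>_def)
      ultimately show ?thesis using conv[of t] by (simp only: char_normal_distribution)
    qed
  qed
  thus ?thesis
    using pos unfolding CLT_holds_def S_def[abs_def] \<sigma>_def by blast
qed

end
section \<open>The approximation and central limit theorem\<close>

theorem theorem3:
  fixes M :: "'a measure" and T :: "'a \<Rightarrow> 'a" and h :: "'a \<Rightarrow> real"
  assumes "prob_space M"
    and "measure_preserving M T"
    and "square_integrable M h"
    and "(\<integral>y. h y \<partial>M) = 0"
    and "summable (\<lambda>m. real (Suc m) powr (- 3 / 2) *
           L2_norm M (\<lambda>y. \<Sum>k<Suc m. (transfer_op M T ^^ k) h y))"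
  shows "\<exists>h'. square_integrable M h' \<and>
              (AE y in M. transfer_op M T h' y = 0) \<and>
              (\<lambda>n. L2_norm M (\<lambda>y. (1 / sqrt (real n)) *
                 (\<Sum>j<n. h ((T ^^ j) y) - h' ((T ^^ j) y)))) \<longlonglongrightarrow> 0 \<and>
              (ergodic M T \<longrightarrow> L2_norm M h' > 0 \<longrightarrow> CLT_holds M T h)"
proof -
  interpret prob_space M by fact
  interpret observable M T h by unfold_locales fact+
  obtain h' where h': "square_integrable M h'" "is_transfer M T h' (\<lambda>y. 0)"
    and lim: "(\<lambda>n. L2_norm M (\<lambda>y. (1 / sqrt (real n)) *
      (\<Sum>j<n. h ((T ^^ j) y) - h' ((T ^^ j) y)))) \<longlonglongrightarrow> 0"
    using martingale_approximation assms(5) unfolding partial_sum_def by blast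
  have "AE y in M. transfer_op M T h' y = 0"
    by (rule is_transfer_unique[OF transfer_op_square_integrable(1)[OF h'(1)] h'(2)])
  moreover have "CLT_holds M T h" if "ergodic M T" "0 < L2_norm M h'"
    by (rule clt_from_kernel_approximation[OF that(1) h h' that(2) lim])
  ultimately show ?thesis using h'(1) lim by blast
qed

end
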